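(* Let $G$ be a finite group with $G=N_{\mathscr{U}}(G)$. Then $G$ is solvable. In particular, for every finite group $G$, the subgroups $N_{\mathscr{U}}(G)$ and $N^{\infty}_{\mathscr{U}}(G)$ are solvable.
   Context: All groups are finite. $\mathscr{U}$ is the class of supersolvable groups. For a group $T$, $T^{\mathscr{U}}$ (the supersolvable residual) is the intersection of all normal subgroups $N$ of $T$ with $T/N\in\mathscr{U}$. The norm is $N_{\mathscr{U}}(G)=\bigcap_{T\le G}N_G(T^{\mathscr{U}})$, over all subgroups $T$ of $G$. Set $N^0_{\mathscr{U}}(G)=1$ and define $N^{i+1}_{\mathscr{U}}(G)$ by $N^{i+1}_{\mathscr{U}}(G)/N^{i}_{\mathscr{U}}(G)=N_{\mathscr{U}}(G/N^{i}_{\mathscr{U}}(G))$; $N^{\infty}_{\mathscr{U}}(G)$ is the terminal term of this ascending series. *)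

theory Defs
  imports "HOL-Algebra.Algebra"
begin

text \<open>A group is supersolvable if it has a series from the trivial subgroup to the whole group
  all of whose terms are normal in the whole group (not merely in the next term) and whose
  consecutive factors are cyclic.\<close>

inductive supersolvable_seq :: "('a, 'b) monoid_scheme \<Rightarrow> 'a set \<Rightarrow> bool"
  for G where
    unity: "supersolvable_seq G {\<one>\<^bsub>G\<^esub>}"
  | extension: "\<lbrakk>supersolvable_seq G K; K \<lhd> (G\<lparr>carrier := H\<rparr>); H \<lhd> G;
                 cyclic_group ((G\<lparr>carrier := H\<rparr>) Mod K)\<rbrakk> \<Longrightarrow> supersolvable_seq G H"

definition supersolvable :: "('a, 'b) monoid_scheme \<Rightarrow> bool"
  where "supersolvable G \<longleftrightarrow> group G \<and> supersolvable_seq G (carrier G)"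

definition supersolvable_residual :: "('a, 'b) monoid_scheme \<Rightarrow> 'a set"
  where "supersolvable_residual T = \<Inter>{N. N \<lhd> T \<and> supersolvable (T Mod N)}"

definition supersolvable_norm :: "('a, 'b) monoid_scheme \<Rightarrow> 'a set"
  where "supersolvable_norm G =
    (\<Inter>T\<in>{T. subgroup T G}. normalizer G (supersolvable_residual (G\<lparr>carrier := T\<rparr>)))"

text \<open>The condition \<open>N\<^sub>i\<^sub>+\<^sub>1 / N\<^sub>i = supersolvable_norm (G / N\<^sub>i)\<close> says that \<open>N\<^sub>i\<^sub>+\<^sub>1\<close> is the preimage of
  \<open>supersolvable_norm (G / N\<^sub>i)\<close> under the projection \<open>x \<mapsto> N\<^sub>i x\<close>.\<close>

primrec supersolvable_norm_series :: "('a, 'b) monoid_scheme \<Rightarrow> nat \<Rightarrow> 'a set" where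
  "supersolvable_norm_series G 0 = {\<one>\<^bsub>G\<^esub>}"
| "supersolvable_norm_series G (Suc i) =
     {x \<in> carrier G. supersolvable_norm_series G i #>\<^bsub>G\<^esub> x
        \<in> supersolvable_norm (G Mod supersolvable_norm_series G i)}"

text \<open>The terminal term, for finite \<open>G\<close>. The series is ascending, so it becomes stationary; as each
  term depends only on its predecessor, it is constant from the first repetition on.\<close>

definition supersolvable_norm_infinity :: "('a, 'b) monoid_scheme \<Rightarrow> 'a set"
  where "supersolvable_norm_infinity G = supersolvable_norm_series G
    (LEAST i. supersolvable_norm_series G (Suc i) = supersolvable_norm_series G i)"

end

theory Submission
  imports Defs "HOL-Number_Theory.Residues"
begin

text \<open>Let all supersolvable residuals of subgroups be normal in \<open>G\<close>. Subgroups inherit this, so it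
  suffices, by induction on the order, to show that \<open>G / S\<close> is solvable for a maximal proper normal
  subgroup \<open>S\<close>. For \<open>S \<subseteq> T \<subset> G\<close> the image of the residual of \<open>T\<close> in the simple group \<open>G / S\<close> is normal and
  proper, hence trivial. Thus \<open>T / S\<close> is a quotient of \<open>T\<close> modulo its residual and therefore supersolvable.
  So \<open>G / S\<close> is a simple group all of whose proper subgroups are supersolvable. The substance of
  the proof is that such a group \<open>Q\<close> is abelian (\<open>simple_group_with_supersolvable_subgroups_comm\<close>).

  Let \<open>p\<close> be the smallest prime divisor of the order of \<open>Q\<close>, let \<open>P\<close> be a Sylow \<open>p\<close>-subgroup, and suppose that
  \<open>Q\<close> is not a \<open>p\<close>-group (a simple \<open>p\<close>-group equals its
  center). If \<open>D\<close> is a nontrivial \<open>p\<close>-subgroup, then its normalizer is proper, hence supersolvable. A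
  cyclic \<open>p\<close>-group has no automorphism of prime order \<open>q > p\<close>; climbing a supersolvable series, one finds that
  the elements of \<open>q\<close>-power order in \<open>N(D)\<close> centralize \<open>D\<close> (\<open>supersolvable_seq_centralizes\<close>). An argument of
  Frobenius deduces that elements of \<open>P\<close> that are conjugate in \<open>Q\<close> are already conjugate in \<open>P\<close>
  (\<open>sylow_controls_fusion\<close>). Consequently the transfer of a nontrivial homomorphism from \<open>P\<close> to an abelian
  group is nontrivial on \<open>Q\<close> (\<open>transfer_hom_exists\<close>), and by simplicity its kernel is trivial.

  Two facts about residuals are needed besides. The quotient by the residual is supersolvable, because the normal
  subgroups with supersolvable quotient are closed under intersection. And residuals are
  compatible with conjugation, so that the norm is normal and the terms of the norm series are
  normal as well. The norm itself satisfies the hypothesis of the first paragraph, hence is solvable, and the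
  terms of the series are solvable as iterated extensions of norms of quotients.\<close>

(* The unqualified name is to denote primality of numbers, not of elements of a monoid. *)
hide_const (open) Divisibility.prime

section \<open>Actions of p-groups\<close>

text \<open>The moved points are a union of orbits, and the length of such an orbit is a power of \<open>p\<close>
  other than \<open>1\<close>.\<close>

lemma (in group) p_subgroup_moved_points:
  assumes H: "subgroup H G" and card_H: "card H = p ^ k" and p: "prime p" and fin: "finite E"
    and closed: "\<And>g x. g \<in> H \<Longrightarrow> x \<in> E \<Longrightarrow> \<phi> g x \<in> E"
    and one: "\<And>x. x \<in> E \<Longrightarrow> \<phi> \<one> x = x"
    and mult: "\<And>g h x. g \<in> H \<Longrightarrow> h \<in> H \<Longrightarrow> x \<in> E \<Longrightarrow> \<phi> (g \<otimes> h) x = \<phi> g (\<phi> h x)"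
  shows "p dvd card {x \<in> E. \<exists>g\<in>H. \<phi> g x \<noteq> x}"
proof -
  interpret H: group "G\<lparr>carrier := H\<rparr>"
    using H by (rule subgroup_imp_group)
  define \<psi> where "\<psi> = (\<lambda>g. restrict (\<phi> g) E)"
  have inv_H: "inv g \<in> H" if "g \<in> H" for g
    using H that by (rule subgroup.m_inv_closed)
  have g_carr: "g \<in> carrier G" if "g \<in> H" for g
    using H that by (rule subgroup.mem_carrier)
  have bij: "bij_betw (\<phi> g) E E" if g: "g \<in> H" for g
  proof (rule bij_betw_byWitness[where f' = "\<phi> (inv g)"])
    show "\<forall>x\<in>E. \<phi> (inv g) (\<phi> g x) = x"
      using mult[OF inv_H[OF g] g] one g_carr[OF g] by simp
    show "\<forall>x\<in>E. \<phi> g (\<phi> (inv g) x) = x"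
      using mult[OF g inv_H[OF g]] one g_carr[OF g] by simp
  qed (use closed g inv_H in auto)
  have psi_Bij: "\<psi> g \<in> Bij E" if "g \<in> H" for g
    using bij[OF that] unfolding Bij_def \<psi>_def by (auto cong: bij_betw_cong)
  have "\<psi> \<in> hom (G\<lparr>carrier := H\<rparr>) (BijGroup E)"
  proof (rule homI)
    fix g h assume gh: "g \<in> carrier (G\<lparr>carrier := H\<rparr>)" "h \<in> carrier (G\<lparr>carrier := H\<rparr>)"
    show "\<psi> (g \<otimes>\<^bsub>G\<lparr>carrier := H\<rparr>\<^esub> h) = \<psi> g \<otimes>\<^bsub>BijGroup E\<^esub> \<psi> h"
      using gh psi_Bij mult closed
      by (auto simp: BijGroup_def \<psi>_def compose_def restrict_def fun_eq_iff)
  qed (use psi_Bij in \<open>auto simp: BijGroup_def\<close>)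
  then interpret act: group_action "G\<lparr>carrier := H\<rparr>" E \<psi>
    unfolding group_action_def group_hom_def group_hom_axioms_def
    using H.is_group group_BijGroup by blast
  let ?M = "{x \<in> E. \<exists>g\<in>H. \<phi> g x \<noteq> x}"
  let ?orb = "orbit (G\<lparr>carrier := H\<rparr>) \<psi>"
  have orb_sub: "?orb x \<subseteq> ?M" if x: "x \<in> ?M" for x
  proof
    fix y assume y: "y \<in> ?orb x"
    then obtain g where g: "g \<in> H" "y = \<phi> g x"
      using x unfolding orbit_def \<psi>_def by auto
    obtain h where h: "h \<in> H" "\<phi> h x \<noteq> x"
      using x by auto
    have yE: "y \<in> E"
      using closed g x by auto
    have x_y: "\<phi> (inv g) y = x"
      using mult[OF inv_H[OF g(1)] g(1), of x] one g g_carr[OF g(1)] x by simp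
    show "y \<in> ?M"
    proof (rule ccontr)
      assume "y \<notin> ?M"
      then have fix_y: "\<phi> u y = y" if "u \<in> H" for u
        using yE that by auto
      then have "x = y"
        using x_y inv_H[OF g(1)] by auto
      then show False
        using fix_y h by auto
    qed
  qed
  have orb_self: "x \<in> ?orb x" if "x \<in> E" for x
    using act.orbit_refl[OF that] .
  have union: "?M = \<Union> (?orb ` ?M)"
    using orb_sub orb_self by blast
  have dvd_orb: "p dvd card (?orb x)" if x: "x \<in> ?M" for x
  proof -
    have "order (G\<lparr>carrier := H\<rparr>) = card (?orb x) * card (stabilizer (G\<lparr>carrier := H\<rparr>) \<psi> x)"
      using act.orbit_stabilizer_theorem[of x] x by auto
    then have "card (?orb x) dvd p ^ k"
      using card_H by (auto simp: order_def)
    then obtain i where i: "card (?orb x) = p ^ i"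
      using p divides_primepow_nat by blast
    have "i \<noteq> 0"
    proof
      assume "i = 0"
      then have "card (?orb x) = 1"
        using i by simp
      then obtain y where y: "?orb x = {y}"
        by (auto simp: card_1_singleton_iff)
      moreover have "x \<in> ?orb x"
        using orb_self x by blast
      ultimately have "?orb x = {x}"
        by simp
      then have "\<phi> g x = x" if "g \<in> H" for g
        using that x unfolding orbit_def \<psi>_def by auto
      then show False using x by auto
    qed
    then show ?thesis
      using i by simp
  qed
  have "p dvd card (\<Union> (?orb ` ?M))"
  proof (rule dvd_partition)
    show "finite (\<Union> (?orb ` ?M))"
      using union fin by (metis (no_types, lifting) finite_subset mem_Collect_eq subsetI)
    show "\<forall>c\<in>?orb ` ?M. p dvd card c"
      using dvd_orb by auto
    show "\<forall>c1\<in>?orb ` ?M. \<forall>c2\<in>?orb ` ?M. c1 \<noteq> c2 \<longrightarrow> c1 \<inter> c2 = {}"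
      using act.disjoint_union unfolding orbits_def by fast
  qed
  then show ?thesis
    using union by simp
qed

definition conj_set :: "('a, 'b) monoid_scheme \<Rightarrow> 'a \<Rightarrow> 'a set \<Rightarrow> 'a set"
  where "conj_set G g H = (\<lambda>x. g \<otimes>\<^bsub>G\<^esub> x \<otimes>\<^bsub>G\<^esub> inv\<^bsub>G\<^esub> g) ` H"

context group
begin

lemma conj_mult:
  "g \<in> carrier G \<Longrightarrow> h \<in> carrier G \<Longrightarrow> x \<in> carrier G \<Longrightarrow>
    g \<otimes> (h \<otimes> x \<otimes> inv h) \<otimes> inv g = (g \<otimes> h) \<otimes> x \<otimes> inv (g \<otimes> h)"
  by (simp add: inv_mult_group m_assoc)

lemma conj_hom:
  "g \<in> carrier G \<Longrightarrow> x \<in> carrier G \<Longrightarrow> y \<in> carrier G \<Longrightarrow>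
    g \<otimes> (x \<otimes> y) \<otimes> inv g = (g \<otimes> x \<otimes> inv g) \<otimes> (g \<otimes> y \<otimes> inv g)"
  by (simp add: m_assoc inv_solve_left)

lemma conj_cancel:
  "g \<in> carrier G \<Longrightarrow> x \<in> carrier G \<Longrightarrow> inv g \<otimes> (g \<otimes> x \<otimes> inv g) \<otimes> g = x"
  by (metis inv_closed inv_inv conj_mult l_inv l_one r_one inv_one)

lemma conj_group_hom: "g \<in> carrier G \<Longrightarrow> group_hom G G (\<lambda>x. g \<otimes> x \<otimes> inv g)"
  by (auto simp: group_hom_def group_hom_axioms_def hom_def conj_hom)

lemma conj_set_subgroup:
  assumes "subgroup H G" "g \<in> carrier G" shows "subgroup (conj_set G g H) G"
  unfolding conj_set_def
  using group_hom.subgroup_img_is_subgroup[OF conj_group_hom[OF assms(2)] assms(1)] .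

lemma conj_set_mult:
  "H \<subseteq> carrier G \<Longrightarrow> g \<in> carrier G \<Longrightarrow> h \<in> carrier G \<Longrightarrow>
    conj_set G g (conj_set G h H) = conj_set G (g \<otimes> h) H"
  unfolding conj_set_def image_image by (rule image_cong) (auto simp: conj_mult)

lemma conj_set_one: "H \<subseteq> carrier G \<Longrightarrow> conj_set G \<one> H = H"
  unfolding conj_set_def by (force simp: image_iff)

lemma conj_set_inv:
  "H \<subseteq> carrier G \<Longrightarrow> g \<in> carrier G \<Longrightarrow> conj_set G (inv g) (conj_set G g H) = H"
  by (simp add: conj_set_mult conj_set_one)

lemma card_conj_set: "H \<subseteq> carrier G \<Longrightarrow> g \<in> carrier G \<Longrightarrow> card (conj_set G g H) = card H"
  unfolding conj_set_def by (rule card_image) (auto simp: inj_on_def subset_iff)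

lemma conj_set_mono: "H \<subseteq> K \<Longrightarrow> conj_set G g H \<subseteq> conj_set G g K"
  by (auto simp: conj_set_def)

lemma mem_conj_set_iff:
  assumes "H \<subseteq> carrier G" "g \<in> carrier G" "x \<in> carrier G"
  shows "x \<in> conj_set G g H \<longleftrightarrow> inv g \<otimes> x \<otimes> g \<in> H"
proof
  assume "x \<in> conj_set G g H"
  then show "inv g \<otimes> x \<otimes> g \<in> H"
    using assms conj_cancel by (auto simp: conj_set_def subset_iff)
next
  assume "inv g \<otimes> x \<otimes> g \<in> H"
  then have "g \<otimes> (inv g \<otimes> x \<otimes> g) \<otimes> inv g \<in> conj_set G g H"
    by (auto simp: conj_set_def)
  then show "x \<in> conj_set G g H"
    using assms conj_cancel[of "inv g" x] by simp
qed

lemma coset_action_fixed_iff: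
  assumes "subgroup P G" "g \<in> carrier G" "x \<in> carrier G"
  shows "P #> g #> x = P #> g \<longleftrightarrow> g \<otimes> x \<otimes> inv g \<in> P"
proof -
  have "P #> g #> x = P #> (g \<otimes> x)"
    using assms by (simp add: coset_mult_assoc subgroup.subset)
  also have "\<dots> = P #> g \<longleftrightarrow> g \<otimes> x \<in> P #> g"
    using assms by (metis m_closed repr_independence repr_independenceD)
  also have "\<dots> \<longleftrightarrow> g \<otimes> x \<otimes> inv g \<in> P"
    using assms by (simp add: subgroup.rcos_module)
  finally show ?thesis .
qed

text \<open>The count of moved points for the action \<open>x \<cdot> P g = P g x\<^sup>-\<^sup>1\<close> on right cosets. It yields both that
  \<open>p\<close>-subgroups are conjugate into Sylow subgroups and that normalizers grow in \<open>p\<close>-groups.\<close>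

lemma p_subgroup_moved_cosets:
  assumes fin: "finite (rcosets P)" and p: "prime p" and P: "subgroup P G"
    and Q: "subgroup Q G" and card_Q: "card Q = p ^ k"
  shows "p dvd card {C \<in> rcosets P. \<exists>x\<in>Q. C #> inv x \<noteq> C}"
proof (rule p_subgroup_moved_points[OF Q card_Q p fin])
  fix x C assume "x \<in> Q" and C: "C \<in> rcosets P"
  then have x: "x \<in> carrier G"
    using subgroup.mem_carrier[OF Q] by blast
  obtain g where g: "g \<in> carrier G" "C = P #> g"
    using C by (auto simp: RCOSETS_def)
  have "C #> inv x = P #> (g \<otimes> inv x)"
    using g x subgroup.subset[OF P] by (simp add: coset_mult_assoc)
  then show "C #> inv x \<in> rcosets P"
    using g x subgroup.subset[OF P] by (simp add: rcosetsI)
  fix y assume "y \<in> Q"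
  then have "y \<in> carrier G"
    using subgroup.mem_carrier[OF Q] by blast
  then show "C #> inv (y \<otimes> x) = C #> inv x #> inv y"
    using x subgroup.rcosets_carrier[OF P is_group C] by (simp add: coset_mult_assoc inv_mult_group)
next
  fix C assume C: "C \<in> rcosets P"
  then show "C #> inv \<one> = C"
    using subgroup.rcosets_carrier[OF P is_group] by simp
qed

text \<open>Some coset \<open>P g\<close> is fixed by right multiplication with every element of \<open>Q\<close>, as the number of all
  cosets is prime to \<open>p\<close>; and \<open>P g x = P g\<close> is the assertion that \<open>g\<close> conjugates \<open>x\<close> into \<open>P\<close>.\<close>

lemma p_subgroup_conj_into_sylow:
  assumes fin: "finite (carrier G)" and p: "prime p" and P: "subgroup P G"
    and index: "\<not> p dvd card (rcosets P)" and Q: "subgroup Q G" and card_Q: "card Q = p ^ k"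
  shows "\<exists>g\<in>carrier G. \<forall>x\<in>Q. g \<otimes> x \<otimes> inv g \<in> P"
proof -
  let ?\<phi> = "\<lambda>x C. C #> inv x"
  have Q_carr: "Q \<subseteq> carrier G" and P_carr: "P \<subseteq> carrier G"
    using P Q subgroup.subset by auto
  have "finite (rcosets P)"
    using fin P_carr rcosets_finite by (simp add: RCOSETS_def)
  then have "p dvd card {C \<in> rcosets P. \<exists>x\<in>Q. ?\<phi> x C \<noteq> C}"
    using p_subgroup_moved_cosets p P Q card_Q by blast
  then have "{C \<in> rcosets P. \<exists>x\<in>Q. ?\<phi> x C \<noteq> C} \<noteq> rcosets P"
    using index by metis
  then obtain C where C: "C \<in> rcosets P" "\<And>x. x \<in> Q \<Longrightarrow> C #> inv x = C"
    by blast
  obtain g where g: "g \<in> carrier G" "C = P #> g"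
    using C by (auto simp: RCOSETS_def)
  have "g \<otimes> x \<otimes> inv g \<in> P" if x: "x \<in> Q" for x
  proof -
    have x_carr: "x \<in> carrier G"
      using x Q_carr by blast
    have "P #> g #> x = P #> g"
      using C(2)[OF subgroup.m_inv_closed[OF Q x]] x_carr unfolding g(2) by simp
    then show ?thesis
      using coset_action_fixed_iff[OF P g(1) x_carr] by simp
  qed
  then show ?thesis
    using g by blast
qed

text \<open>Let \<open>D\<close> act on its own cosets. Both the index of \<open>D\<close> and the number of moved cosets are divisible by
  \<open>p\<close>, so \<open>D\<close> is not the only fixed coset; the representatives of a further one normalize \<open>D\<close>.\<close>

lemma p_group_normalizer_grows:
  assumes card: "order G = p ^ k" and p: "prime p" and D: "subgroup D G" "D \<noteq> carrier G"
  shows "\<exists>x\<in>carrier G - D. \<forall>d\<in>D. x \<otimes> d \<otimes> inv x \<in> D"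
proof -
  have fin: "finite (carrier G)"
    using card p by (metis order_gt_0_iff_finite prime_gt_0_nat zero_less_power)
  have D_carr: "D \<subseteq> carrier G"
    using D subgroup.subset by auto
  have cards: "card (rcosets D) * card D = p ^ k"
    using lagrange[OF D(1)] card by simp
  have "card D dvd p ^ k"
    unfolding cards[symmetric] by simp
  then obtain i where i: "card D = p ^ i"
    using divides_primepow_nat[OF p] by auto
  have "card (rcosets D) dvd p ^ k"
    unfolding cards[symmetric] by simp
  then obtain j where j: "card (rcosets D) = p ^ j"
    using divides_primepow_nat[OF p] by auto
  have "j \<noteq> 0"
  proof
    assume "j = 0"
    then have "card D = card (carrier G)"
      using cards j card by (simp add: order_def)
    then show False
      using D D_carr fin card_subset_eq by blast
  qed
  then have p_index: "p dvd card (rcosets D)"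
    using j by simp
  let ?\<phi> = "\<lambda>x C. C #> inv x"
  let ?M = "{C \<in> rcosets D. \<exists>x\<in>D. ?\<phi> x C \<noteq> C}"
  have fin_cosets: "finite (rcosets D)"
    using p_index j p by (metis card.infinite not_prime_0 power_not_zero)
  have "p dvd card ?M"
    using p_subgroup_moved_cosets[OF fin_cosets p D(1) D(1) i] .
  then have dvd: "p dvd card (rcosets D - ?M)"
    using p_index fin_cosets by (subst card_Diff_subset) (auto intro: dvd_diff_nat)
  have D_fixed: "D \<in> rcosets D - ?M"
  proof -
    have "D #> inv x = D" if "x \<in> D" for x
      using that D(1) D_carr subgroup.m_inv_closed[OF D(1)] by (intro coset_join2) auto
    then show ?thesis
      using subgroup.subgroup_in_rcosets[OF D(1)] is_group by auto
  qed
  have "rcosets D - ?M \<noteq> {D}"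
    using dvd p by auto
  then obtain C where C: "C \<in> rcosets D" "C \<noteq> D" "\<And>x. x \<in> D \<Longrightarrow> C #> inv x = C"
    using D_fixed by blast
  obtain g where g: "g \<in> carrier G" "C = D #> g"
    using C by (auto simp: RCOSETS_def)
  have "g \<notin> D"
    using g C(2) coset_join2[OF g(1) D(1)] by auto
  moreover have "g \<otimes> x \<otimes> inv g \<in> D" if x: "x \<in> D" for x
  proof -
    have x_carr: "x \<in> carrier G"
      using x D_carr by blast
    have "D #> g #> x = D #> g"
      using C(3)[OF subgroup.m_inv_closed[OF D(1) x]] x_carr unfolding g(2) by simp
    then show ?thesis
      using coset_action_fixed_iff[OF D(1) g(1) x_carr] by simp
  qed
  ultimately show ?thesis
    using g by blast
qed

text \<open>The points moved by conjugation are the noncentral elements. Their number is divisible by \<open>p\<close>, as is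
  the order of the group, and hence that of the center, which contains \<open>\<one>\<close>.\<close>

lemma p_group_center_nontrivial:
  assumes card: "order G = p ^ k" and p: "prime p" and nontriv: "order G \<noteq> 1"
  shows "\<exists>z\<in>carrier G - {\<one>}. \<forall>g\<in>carrier G. g \<otimes> z = z \<otimes> g"
proof -
  have fin: "finite (carrier G)"
    using card p by (metis order_gt_0_iff_finite prime_gt_0_nat zero_less_power)
  let ?\<phi> = "\<lambda>g x. g \<otimes> x \<otimes> inv g"
  let ?M = "{x \<in> carrier G. \<exists>g\<in>carrier G. ?\<phi> g x \<noteq> x}"
  have "p dvd card ?M"
    using card by (intro p_subgroup_moved_points[OF subgroup_self _ p fin])
      (auto simp: order_def conj_mult)
  moreover have "p dvd card (carrier G)"
    using card nontriv unfolding order_def by (cases k) auto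
  ultimately have dvd: "p dvd card (carrier G - ?M)"
    using fin by (subst card_Diff_subset) (auto intro: dvd_diff_nat)
  have "carrier G - ?M \<noteq> {\<one>}"
    using dvd p by auto
  moreover have "\<one> \<in> carrier G - ?M"
    by auto
  ultimately obtain z where z: "z \<in> carrier G" "z \<noteq> \<one>" "\<And>g. g \<in> carrier G \<Longrightarrow> ?\<phi> g z = z"
    by blast
  have "g \<otimes> z = z \<otimes> g" if "g \<in> carrier G" for g
    using z(3)[OF that] z(1) that by (metis inv_solve_right m_closed inv_closed)
  then show ?thesis
    using z by blast
qed

lemma simple_p_group_comm:
  assumes card: "order G = p ^ k" and p: "prime p"
    and simple: "\<And>N. N \<lhd> G \<Longrightarrow> N = carrier G \<or> N = {\<one>}"
  shows "comm_group G"
proof (cases "order G = 1")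
  case True
  then obtain a where "carrier G = {a}"
    unfolding order_def by (auto simp: card_1_singleton_iff)
  then show ?thesis
    by (intro group_comm_groupI) auto
next
  case False
  let ?Z = "{z \<in> carrier G. \<forall>g\<in>carrier G. g \<otimes> z = z \<otimes> g}"
  have "subgroup ?Z G"
  proof (rule subgroupI)
    fix a assume "a \<in> ?Z"
    then have a: "a \<in> carrier G" and a_comm: "\<And>g. g \<in> carrier G \<Longrightarrow> g \<otimes> a = a \<otimes> g"
      by auto
    have "g \<otimes> inv a = inv a \<otimes> g" if g: "g \<in> carrier G" for g
    proof -
      have "g \<otimes> inv a = inv a \<otimes> (a \<otimes> g) \<otimes> inv a"
        using a g by (simp add: m_assoc[symmetric])
      also have "\<dots> = inv a \<otimes> (g \<otimes> a) \<otimes> inv a"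
        by (simp only: a_comm[OF g])
      also have "\<dots> = inv a \<otimes> g"
        using a g by (simp add: m_assoc)
      finally show ?thesis .
    qed
    then show "inv a \<in> ?Z"
      using a by auto
    fix b assume "b \<in> ?Z"
    then have b: "b \<in> carrier G" and b_comm: "\<And>g. g \<in> carrier G \<Longrightarrow> g \<otimes> b = b \<otimes> g"
      by auto
    have "g \<otimes> (a \<otimes> b) = a \<otimes> b \<otimes> g" if g: "g \<in> carrier G" for g
    proof -
      have "g \<otimes> (a \<otimes> b) = (g \<otimes> a) \<otimes> b"
        using a b g by (simp add: m_assoc)
      also have "\<dots> = a \<otimes> (g \<otimes> b)"
        unfolding a_comm[OF g] using a b g by (simp add: m_assoc)
      also have "\<dots> = a \<otimes> b \<otimes> g"
        unfolding b_comm[OF g] using a b g by (simp add: m_assoc)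
      finally show ?thesis .
    qed
    then show "a \<otimes> b \<in> ?Z"
      using a b by auto
  qed auto
  then have "?Z \<lhd> G"
  proof (rule normal_invI)
    fix g z assume "g \<in> carrier G" "z \<in> ?Z"
    then have "g \<otimes> z = z \<otimes> g" "g \<in> carrier G" "z \<in> carrier G"
      by blast+
    then have "g \<otimes> z \<otimes> inv g = z"
      by (simp add: m_assoc)
    then show "g \<otimes> z \<otimes> inv g \<in> ?Z"
      using \<open>z \<in> ?Z\<close> by simp
  qed
  then have "?Z = carrier G"
    using simple p_group_center_nontrivial[OF card p False] by blast
  then have "x \<in> ?Z" if "x \<in> carrier G" for x
    using that by simp
  then show ?thesis
  proof (intro group_comm_groupI)
    fix x y assume "x \<in> carrier G" "y \<in> carrier G"
    then have "y \<in> ?Z" "x \<in> carrier G"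
      using \<open>\<And>x. x \<in> carrier G \<Longrightarrow> x \<in> ?Z\<close> by blast+
    then show "x \<otimes> y = y \<otimes> x"
      by simp
  qed
qed

end

section \<open>The transfer of a conjugation-invariant homomorphism\<close>

text \<open>A homomorphism \<open>\<phi>\<close> from a subgroup \<open>H\<close> to an abelian group, constant on the intersections of \<open>H\<close>
  with the conjugacy classes of \<open>G\<close>. This is the hypothesis under which the transfer
  of \<open>\<phi>\<close> to \<open>G\<close> has a simple value on \<open>H\<close>.\<close>

locale conjugation_invariant_hom = group G + A: comm_group A for G (structure) and A (structure) +
  fixes H :: "'a set" and \<phi>
  assumes finite_carrier: "finite (carrier G)"
    and subgroup_H: "subgroup H G"
    and hom_phi: "\<phi> \<in> hom (G\<lparr>carrier := H\<rparr>) A"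
    and invariant: "\<And>x g. \<lbrakk>x \<in> H; g \<in> carrier G; g \<otimes> x \<otimes> inv g \<in> H\<rbrakk> \<Longrightarrow> \<phi> (g \<otimes> x \<otimes> inv g) = \<phi> x"
begin

lemma H_closed [simp]:
  "x \<in> H \<Longrightarrow> x \<in> carrier G" "x \<in> H \<Longrightarrow> inv x \<in> H" "x \<in> H \<Longrightarrow> y \<in> H \<Longrightarrow> x \<otimes> y \<in> H" "\<one> \<in> H"
  using subgroup_H by (auto simp: subgroup.mem_carrier subgroup.m_inv_closed subgroup.m_closed subgroup.one_closed)

lemma phi_closed [simp]: "x \<in> H \<Longrightarrow> \<phi> x \<in> carrier A"
  using hom_phi by (auto simp: hom_def)

lemma phi_mult [simp]: "x \<in> H \<Longrightarrow> y \<in> H \<Longrightarrow> \<phi> (x \<otimes> y) = \<phi> x \<otimes>\<^bsub>A\<^esub> \<phi> y"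
  using hom_phi by (auto simp: hom_def)

text \<open>Comparing the two factorizations gives \<open>y (k k'\<^sup>-\<^sup>1) y\<^sup>-\<^sup>1 = h\<^sup>-\<^sup>1 h'\<close>, a conjugation inside \<open>H\<close>, which \<open>\<phi>\<close>
  does not see.\<close>

lemma double_coset_value_unique:
  assumes "y \<in> carrier G" "h \<in> H" "k \<in> H" "h' \<in> H" "k' \<in> H" and eq: "h \<otimes> y \<otimes> k = h' \<otimes> y \<otimes> k'"
  shows "\<phi> h \<otimes>\<^bsub>A\<^esub> \<phi> k = \<phi> h' \<otimes>\<^bsub>A\<^esub> \<phi> k'"
proof -
  have *: "y \<otimes> (k \<otimes> inv k') \<otimes> inv y = inv h \<otimes> h'"
  proof -
    have "inv h \<otimes> (h \<otimes> y \<otimes> k) \<otimes> inv k' \<otimes> inv y = inv h \<otimes> (h' \<otimes> y \<otimes> k') \<otimes> inv k' \<otimes> inv y"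
      using eq by simp
    moreover have "inv h \<otimes> (h \<otimes> y \<otimes> k) \<otimes> inv k' \<otimes> inv y = y \<otimes> (k \<otimes> inv k') \<otimes> inv y"
      using assms(1-5) by (simp add: m_assoc[symmetric])
    moreover have "inv h \<otimes> (h' \<otimes> y \<otimes> k') \<otimes> inv k' \<otimes> inv y = inv h \<otimes> h'"
      using assms(1-5) by (simp add: m_assoc)
    ultimately show ?thesis
      by simp
  qed
  then have "\<phi> (inv h \<otimes> h') = \<phi> (k \<otimes> inv k')"
    using invariant[of "k \<otimes> inv k'" y] assms by simp
  moreover have "\<phi> h' = \<phi> h \<otimes>\<^bsub>A\<^esub> \<phi> (inv h \<otimes> h')"
    using assms by (simp add: phi_mult[symmetric] m_assoc[symmetric] del: phi_mult)
  moreover have "\<phi> k = \<phi> (k \<otimes> inv k') \<otimes>\<^bsub>A\<^esub> \<phi> k'"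
    using assms by (simp add: phi_mult[symmetric] m_assoc del: phi_mult)
  ultimately show ?thesis
    using assms by (simp add: A.m_assoc del: phi_mult)
qed

text \<open>Choose a representative \<open>y\<close> of each double coset and put \<open>\<psi> (h y k) = \<phi> h \<cdot> \<phi> k\<close>. Compatibility on the
  left is what the definition of the transfer requires. Having compatibility on the right for the same
  function allows the transfer of an element of \<open>H\<close> to be read off factor by factor, so that the
  orbits of that element on the cosets need not be considered.\<close>

lemma biequivariant_extension_exists:
  obtains \<psi> where "\<And>x. x \<in> carrier G \<Longrightarrow> \<psi> x \<in> carrier A"
    and "\<And>h x k. \<lbrakk>h \<in> H; x \<in> carrier G; k \<in> H\<rbrakk> \<Longrightarrow> \<psi> (h \<otimes> x \<otimes> k) = \<phi> h \<otimes>\<^bsub>A\<^esub> \<psi> x \<otimes>\<^bsub>A\<^esub> \<phi> k"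
proof -
  define D where "D = (\<lambda>x. {y \<in> carrier G. \<exists>h\<in>H. \<exists>k\<in>H. x = h \<otimes> y \<otimes> k})"
  define r where "r = (\<lambda>x. SOME y. y \<in> D x)"
  define \<psi> where "\<psi> = (\<lambda>x. SOME a. \<exists>h\<in>H. \<exists>k\<in>H. x = h \<otimes> r x \<otimes> k \<and> a = \<phi> h \<otimes>\<^bsub>A\<^esub> \<phi> k)"
  have r: "r x \<in> D x" if "x \<in> carrier G" for x
    unfolding r_def
  proof (rule someI)
    show "x \<in> D x"
      using that by (auto simp: D_def intro!: bexI[of _ \<one>])
  qed
  have psi_eq: "\<psi> x = \<phi> h \<otimes>\<^bsub>A\<^esub> \<phi> k" if "x = h \<otimes> r x \<otimes> k" "h \<in> H" "k \<in> H" "x \<in> carrier G" for x h k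
    unfolding \<psi>_def
  proof (rule some_equality)
    fix a assume "\<exists>h\<in>H. \<exists>k\<in>H. x = h \<otimes> r x \<otimes> k \<and> a = \<phi> h \<otimes>\<^bsub>A\<^esub> \<phi> k"
    then obtain h' k' where h'k': "h' \<in> H" "k' \<in> H" "x = h' \<otimes> r x \<otimes> k'" "a = \<phi> h' \<otimes>\<^bsub>A\<^esub> \<phi> k'"
      by blast
    then show "a = \<phi> h \<otimes>\<^bsub>A\<^esub> \<phi> k"
      using double_coset_value_unique[of "r x" h' k' h k] that r[of x] by (auto simp: D_def)
  qed (use that in blast)
  have r_double: "r (h \<otimes> x \<otimes> k) = r x" if hxk: "h \<in> H" "x \<in> carrier G" "k \<in> H" for h x k
  proof -
    have "y \<in> D (h \<otimes> x \<otimes> k)" if y: "y \<in> D x" for y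
    proof -
      obtain h' k' where h'k': "h' \<in> H" "k' \<in> H" "x = h' \<otimes> y \<otimes> k'" "y \<in> carrier G"
        using y by (auto simp: D_def)
      then have "h \<otimes> x \<otimes> k = (h \<otimes> h') \<otimes> y \<otimes> (k' \<otimes> k)"
        using hxk by (simp add: m_assoc)
      then show ?thesis
        using h'k' hxk H_closed(3) unfolding D_def by blast
    qed
    moreover have "y \<in> D x" if y: "y \<in> D (h \<otimes> x \<otimes> k)" for y
    proof -
      obtain h' k' where h'k': "h' \<in> H" "k' \<in> H" "h \<otimes> x \<otimes> k = h' \<otimes> y \<otimes> k'" "y \<in> carrier G"
        using y by (auto simp: D_def)
      have "x = inv h \<otimes> (h \<otimes> x \<otimes> k) \<otimes> inv k"
        using hxk by (simp add: m_assoc) (simp add: m_assoc[symmetric])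
      also have "\<dots> = (inv h \<otimes> h') \<otimes> y \<otimes> (k' \<otimes> inv k)"
        unfolding h'k'(3) using h'k' hxk by (simp add: m_assoc)
      finally show ?thesis
        using h'k' hxk H_closed(2,3) unfolding D_def by blast
    qed
    ultimately have "D (h \<otimes> x \<otimes> k) = D x"
      by blast
    then show ?thesis
      by (simp add: r_def)
  qed
  show thesis
  proof (rule that[of \<psi>])
    fix x assume x: "x \<in> carrier G"
    obtain h' k' where h'k': "h' \<in> H" "k' \<in> H" "x = h' \<otimes> r x \<otimes> k'" "r x \<in> carrier G"
      using r[OF x] by (auto simp: D_def)
    have psi_x: "\<psi> x = \<phi> h' \<otimes>\<^bsub>A\<^esub> \<phi> k'"
      using psi_eq h'k' x by blast
    then show "\<psi> x \<in> carrier A"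
      using h'k' by simp
    fix h k assume hk: "h \<in> H" "k \<in> H"
    have "h \<otimes> x \<otimes> k = h \<otimes> (h' \<otimes> r x \<otimes> k') \<otimes> k"
      using h'k'(3) by simp
    also have "\<dots> = (h \<otimes> h') \<otimes> r (h \<otimes> x \<otimes> k) \<otimes> (k' \<otimes> k)"
      unfolding r_double[OF hk(1) x hk(2)] using h'k'(1,2,4) hk by (simp add: m_assoc)
    finally have "\<psi> (h \<otimes> x \<otimes> k) = \<phi> (h \<otimes> h') \<otimes>\<^bsub>A\<^esub> \<phi> (k' \<otimes> k)"
      using psi_eq[of "h \<otimes> x \<otimes> k" "h \<otimes> h'" "k' \<otimes> k"] hk h'k' x by simp
    then show "\<psi> (h \<otimes> x \<otimes> k) = \<phi> h \<otimes>\<^bsub>A\<^esub> \<psi> x \<otimes>\<^bsub>A\<^esub> \<phi> k"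
      using h'k' hk psi_x by (simp add: A.m_assoc)
  qed
qed

text \<open>The choice of representatives does not matter when \<open>f\<close> is constant on the right cosets of \<open>H\<close>.\<close>

definition coset_prod :: "('a \<Rightarrow> 'c) \<Rightarrow> 'c"
  where "coset_prod f = finprod A (\<lambda>C. f (SOME x. x \<in> C)) (rcosets H)"

lemma some_in_coset: "C \<in> rcosets H \<Longrightarrow> (SOME x. x \<in> C) \<in> C"
  using subgroup.rcosets_non_empty[OF subgroup_H] some_in_eq by blast

lemma coset_subset: "C \<in> rcosets H \<Longrightarrow> C \<subseteq> carrier G"
  using subgroup.rcosets_carrier[OF subgroup_H is_group] .

lemma coset_prod_mult:
  assumes "\<And>x. x \<in> carrier G \<Longrightarrow> f x \<in> carrier A" "\<And>x. x \<in> carrier G \<Longrightarrow> f' x \<in> carrier A"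
  shows "coset_prod (\<lambda>x. f x \<otimes>\<^bsub>A\<^esub> f' x) = coset_prod f \<otimes>\<^bsub>A\<^esub> coset_prod f'"
  unfolding coset_prod_def using assms some_in_coset coset_subset
  by (intro A.finprod_multf) blast+

lemma coset_prod_cong:
  assumes "\<And>x. x \<in> carrier G \<Longrightarrow> f x = f' x" "\<And>x. x \<in> carrier G \<Longrightarrow> f' x \<in> carrier A"
  shows "coset_prod f = coset_prod f'"
  unfolding coset_prod_def using assms some_in_coset coset_subset
  by (intro A.finprod_cong') blast+

lemma coset_prod_shift:
  assumes closed: "\<And>x. x \<in> carrier G \<Longrightarrow> f x \<in> carrier A"
    and const: "\<And>h x. h \<in> H \<Longrightarrow> x \<in> carrier G \<Longrightarrow> f (h \<otimes> x) = f x" and g: "g \<in> carrier G"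
  shows "coset_prod (\<lambda>x. f (x \<otimes> g)) = coset_prod f"
proof -
  have H_sub: "H \<subseteq> carrier G"
    by auto
  have shift_mem: "C #> a \<in> rcosets H" if "C \<in> rcosets H" "a \<in> carrier G" for C a
    using that H_sub by (auto simp: RCOSETS_def coset_mult_assoc)
  have bij: "bij_betw (\<lambda>C. C #> g) (rcosets H) (rcosets H)"
    by (rule bij_betw_byWitness[where f' = "\<lambda>C. C #> inv g"])
      (use g shift_mem coset_subset in \<open>auto simp: coset_mult_assoc coset_mult_one\<close>)
  have const': "f x = f y" if C: "C \<in> rcosets H" "x \<in> C" "y \<in> C" for C x y
  proof -
    obtain z where z: "z \<in> carrier G" "C = H #> z"
      using C by (auto simp: RCOSETS_def)
    then show ?thesis
      using C const by (auto simp: r_coset_def)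
  qed
  have "coset_prod (\<lambda>x. f (x \<otimes> g)) = finprod A (\<lambda>C. f (SOME x. x \<in> C #> g)) (rcosets H)"
    unfolding coset_prod_def
  proof (rule A.finprod_cong')
    fix C assume C: "C \<in> rcosets H"
    have "(SOME x. x \<in> C) \<otimes> g \<in> C #> g"
      using some_in_coset[OF C] by (auto simp: r_coset_def)
    then show "f ((SOME x. x \<in> C) \<otimes> g) = f (SOME x. x \<in> C #> g)"
      using const' shift_mem[OF C g] some_in_coset by blast
  next
    show "(\<lambda>C. f (SOME x. x \<in> C #> g)) \<in> rcosets H \<rightarrow> carrier A"
      using closed shift_mem g some_in_coset coset_subset by blast
  qed simp
  also have "\<dots> = finprod A (\<lambda>C. f (SOME x. x \<in> C)) ((\<lambda>C. C #> g) ` (rcosets H))"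
    using bij closed some_in_coset coset_subset
    by (intro A.finprod_reindex[symmetric]) (auto simp: bij_betw_def)
  also have "\<dots> = coset_prod f"
    using bij by (simp add: coset_prod_def bij_betw_def)
  finally show ?thesis .
qed

text \<open>The transfer of \<open>\<phi>\<close>. The ratio \<open>\<psi> (x g) / \<psi> x\<close> depends on \<open>x\<close> only through its coset \<open>H x\<close> and
  satisfies a cocycle identity in \<open>g\<close>, which turns into multiplicativity in the product over all cosets because
  right multiplication permutes the cosets. For \<open>g = u\<close> in \<open>H\<close> each ratio is \<open>\<phi> u\<close>.\<close>

theorem transfer_hom_exists:
  obtains V where "V \<in> hom G A" and "\<And>u. u \<in> H \<Longrightarrow> V u = \<phi> u [^]\<^bsub>A\<^esub> card (rcosets H)"
proof -
  obtain \<psi> where closed: "\<And>x. x \<in> carrier G \<Longrightarrow> \<psi> x \<in> carrier A"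
    and biequi: "\<And>h x k. \<lbrakk>h \<in> H; x \<in> carrier G; k \<in> H\<rbrakk> \<Longrightarrow> \<psi> (h \<otimes> x \<otimes> k) = \<phi> h \<otimes>\<^bsub>A\<^esub> \<psi> x \<otimes>\<^bsub>A\<^esub> \<phi> k"
    by (rule biequivariant_extension_exists) (rule that)
  have phi_one: "\<phi> \<one> = \<one>\<^bsub>A\<^esub>"
    using phi_mult[of \<one> \<one>] by (simp del: phi_mult) 
  have left: "\<psi> (h \<otimes> x) = \<phi> h \<otimes>\<^bsub>A\<^esub> \<psi> x" if "h \<in> H" "x \<in> carrier G" for h x
    using biequi[OF that, of \<one>] that closed phi_one by simp
  have right: "\<psi> (x \<otimes> k) = \<psi> x \<otimes>\<^bsub>A\<^esub> \<phi> k" if "k \<in> H" "x \<in> carrier G" for k x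
    using biequi[of \<one> x k] that closed phi_one by simp
  define \<rho> where "\<rho> = (\<lambda>g x. \<psi> (x \<otimes> g) \<otimes>\<^bsub>A\<^esub> inv\<^bsub>A\<^esub> \<psi> x)"
  define V where "V = (\<lambda>g. coset_prod (\<rho> g))"
  have rho_closed: "\<rho> g x \<in> carrier A" if "g \<in> carrier G" "x \<in> carrier G" for g x
    using that closed by (simp add: \<rho>_def)
  have rho_const: "\<rho> g (h \<otimes> x) = \<rho> g x" if "h \<in> H" "g \<in> carrier G" "x \<in> carrier G" for g h x
  proof -
    have "\<psi> (h \<otimes> x \<otimes> g) = \<phi> h \<otimes>\<^bsub>A\<^esub> \<psi> (x \<otimes> g)"
      using that left[of h "x \<otimes> g"] by (simp add: m_assoc)
    then have "\<rho> g (h \<otimes> x) = \<phi> h \<otimes>\<^bsub>A\<^esub> \<psi> (x \<otimes> g) \<otimes>\<^bsub>A\<^esub> (inv\<^bsub>A\<^esub> \<phi> h \<otimes>\<^bsub>A\<^esub> inv\<^bsub>A\<^esub> \<psi> x)"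
      using that closed left by (simp add: \<rho>_def A.inv_mult)
    also have "\<dots> = (\<phi> h \<otimes>\<^bsub>A\<^esub> inv\<^bsub>A\<^esub> \<phi> h) \<otimes>\<^bsub>A\<^esub> \<rho> g x"
      using that closed by (simp add: \<rho>_def A.m_ac del: A.l_inv A.r_inv A.Units_l_inv A.Units_r_inv)
    finally show ?thesis
      using that rho_closed by simp
  qed
  have rho_cocycle: "\<rho> (g \<otimes> g') x = \<rho> g x \<otimes>\<^bsub>A\<^esub> \<rho> g' (x \<otimes> g)"
    if "g \<in> carrier G" "g' \<in> carrier G" "x \<in> carrier G" for g g' x
  proof -
    have "\<rho> g x \<otimes>\<^bsub>A\<^esub> \<rho> g' (x \<otimes> g) = (inv\<^bsub>A\<^esub> \<psi> (x \<otimes> g) \<otimes>\<^bsub>A\<^esub> \<psi> (x \<otimes> g)) \<otimes>\<^bsub>A\<^esub> (\<psi> (x \<otimes> g \<otimes> g') \<otimes>\<^bsub>A\<^esub> inv\<^bsub>A\<^esub> \<psi> x)"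
      using that closed by (simp add: \<rho>_def A.m_ac del: A.l_inv A.r_inv A.Units_l_inv A.Units_r_inv)
    then show ?thesis
      using that closed by (simp add: \<rho>_def m_assoc)
  qed
  have V_closed: "V g \<in> carrier A" if "g \<in> carrier G" for g
    unfolding V_def coset_prod_def using that rho_closed some_in_coset coset_subset
    by (intro A.finprod_closed) blast
  show thesis
  proof (rule that)
    show "V \<in> hom G A"
    proof (rule homI)
      fix g g' assume g: "g \<in> carrier G" "g' \<in> carrier G"
      have "V (g \<otimes> g') = coset_prod (\<lambda>x. \<rho> g x \<otimes>\<^bsub>A\<^esub> \<rho> g' (x \<otimes> g))"
        unfolding V_def using g rho_cocycle rho_closed by (intro coset_prod_cong) auto
      also have "\<dots> = V g \<otimes>\<^bsub>A\<^esub> coset_prod (\<lambda>x. \<rho> g' (x \<otimes> g))"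
        unfolding V_def using g rho_closed by (intro coset_prod_mult) auto
      also have "coset_prod (\<lambda>x. \<rho> g' (x \<otimes> g)) = V g'"
        unfolding V_def using g rho_closed rho_const by (intro coset_prod_shift) auto
      finally show "V (g \<otimes> g') = V g \<otimes>\<^bsub>A\<^esub> V g'" .
    qed (rule V_closed)
    fix u assume u: "u \<in> H"
    have "\<rho> u x = \<phi> u" if "x \<in> carrier G" for x
      using right[OF u that] closed[OF that] u by (simp add: \<rho>_def A.m_ac)
    then have "V u = coset_prod (\<lambda>x. \<phi> u)"
      unfolding V_def using u by (intro coset_prod_cong) auto
    then show "V u = \<phi> u [^]\<^bsub>A\<^esub> card (rcosets H)"
      unfolding coset_prod_def using u A.finprod_const[of "\<phi> u" "rcosets H"] by simp
  qed
qed

end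

section \<open>Elements of prime power order in supersolvable groups\<close>

text \<open>Both \<open>q\<^sup>j\<close> and, by Euler's theorem, the totient of \<open>p\<^sup>l\<close> are exponents that send \<open>k\<close> to \<open>1\<close>. They are
  coprime since no prime divisor of the totient exceeds \<open>p\<close>.\<close>

lemma cong_one_of_prime_power_root:
  fixes k :: int
  assumes p: "prime p" and q: "prime q" and pq: "p < q"
    and root: "[k ^ (q ^ j) = 1] (mod int (p ^ l))"
  shows "[k = 1] (mod int (p ^ l))"
proof -
  define m where "m = p ^ l"
  define a where "a = nat (k mod int m)"
  have m_pos: "m > 0"
    using p by (simp add: m_def prime_gt_0_nat)
  have a_k: "[int a = k] (mod int m)"
    using m_pos by (simp add: a_def cong_def)
  then have "[int a ^ (q ^ j) = 1] (mod int m)"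
    using root cong_pow cong_trans unfolding m_def by blast
  then have a_root: "[a ^ (q ^ j) = 1] (mod m)"
    by (metis cong_int_iff of_nat_1 of_nat_power)
  have "coprime (a ^ (q ^ j)) m"
    using a_root by (metis cong_imp_coprime coprime_1_left cong_sym)
  then have "coprime a m"
    using q by (simp add: prime_gt_0_nat)
  then have euler: "[a ^ totient m = 1] (mod m)"
    by (rule euler_theorem)
  have "coprime (q ^ j) (totient m)"
  proof (cases "l = 0")
    case False
    have "\<not> q dvd p" "\<not> q dvd p - 1"
      using prime_gt_1_nat[OF p] pq by (auto dest!: dvd_imp_le)
    then have "coprime q p" "coprime q (p - 1)"
      using q prime_imp_coprime by auto
    then show ?thesis
      using False p by (simp add: m_def totient_prime_power)
  qed (simp add: m_def)
  moreover have "q ^ j \<noteq> 0"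
    using q by simp
  ultimately obtain x y where xy: "q ^ j * x = totient m * y + 1"
    using bezout_nat[of "q ^ j" "totient m"] by auto
  have "[a ^ (q ^ j * x) = 1] (mod m)"
    using cong_pow[OF a_root, of x] by (simp add: power_mult)
  moreover have "[a ^ (totient m * y + 1) = 1 * a] (mod m)"
    using cong_mult[OF cong_pow[OF euler, of y] cong_refl[of a m]]
    by (simp add: power_mult mult.commute[of a])
  ultimately have "[a = 1] (mod m)"
    using xy by (metis cong_sym cong_trans mult_1)
  then have "[int a = 1] (mod int m)"
    by (metis cong_int_iff of_nat_1)
  then show ?thesis
    using a_k cong_sym cong_trans unfolding m_def by blast
qed

context group
begin

lemma conj_int_pow:
  "g \<in> carrier G \<Longrightarrow> x \<in> carrier G \<Longrightarrow> g \<otimes> x [^] (n::int) \<otimes> inv g = (g \<otimes> x \<otimes> inv g) [^] n"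
  using group_hom.hom_int_pow[OF conj_group_hom] .

text \<open>Conjugation by \<open>h\<close> raises every power of \<open>a\<close> to the exponent \<open>k\<close>, so conjugation by \<open>h\<^sup>m\<close>
  raises it to the exponent \<open>k\<^sup>m\<close>. For \<open>m = q\<^sup>j\<close> this is trivial, whence \<open>k\<close> is \<open>1\<close> modulo the order of \<open>x\<close>.\<close>

lemma prime_power_fixes_cyclic_prime_power:
  fixes p q i j :: nat
  assumes carr: "a \<in> carrier G" "h \<in> carrier G" and h_a: "h \<otimes> a \<otimes> inv h = a [^] (k::int)"
    and x: "x = a [^] (n::int)" "x [^] (p ^ i) = \<one>" and h: "h [^] (q ^ j) = \<one>"
    and p: "prime p" and q: "prime q" and pq: "p < q"
  shows "h \<otimes> x \<otimes> inv h = x"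
proof -
  have x_carr: "x \<in> carrier G"
    using x carr by simp
  have h_x: "h \<otimes> x \<otimes> inv h = x [^] k"
    using carr h_a unfolding x(1) by (simp add: conj_int_pow int_pow_pow mult.commute)
  have iter: "h [^] m \<otimes> x \<otimes> inv (h [^] m) = x [^] (k ^ m)" for m :: nat
  proof (induction m)
    case 0
    then show ?case
      using x_carr by simp
  next
    case (Suc m)
    have "h [^] Suc m = h \<otimes> h [^] m"
      using carr nat_pow_Suc2 by blast
    then have "h [^] Suc m \<otimes> x \<otimes> inv (h [^] Suc m) = h \<otimes> (h [^] m \<otimes> x \<otimes> inv (h [^] m)) \<otimes> inv h"
      using carr x_carr by (simp add: conj_mult)
    also have "\<dots> = (x [^] k) [^] (k ^ m)"
      using Suc.IH carr x_carr h_x by (simp add: conj_int_pow)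
    finally show ?case
      using x_carr by (simp add: int_pow_pow)
  qed
  have "x [^] (k ^ (q ^ j)) = x [^] (1::int)"
    using iter[of "q ^ j"] h x_carr by simp
  then have root: "int (ord x) dvd 1 - k ^ (q ^ j)"
    using int_pow_eq x_carr by blast
  have "ord x dvd p ^ i"
    using x(2) x_carr pow_eq_id by blast
  then obtain l where l: "ord x = p ^ l"
    using p divides_primepow_nat by blast
  have "[k ^ (q ^ j) = 1] (mod int (p ^ l))"
    using root l by (metis cong_iff_dvd_diff cong_sym)
  then have "[k = 1] (mod int (p ^ l))"
    using cong_one_of_prime_power_root p q pq by blast
  then have "int (ord x) dvd 1 - k"
    using l by (metis cong_iff_dvd_diff cong_sym)
  then have "x [^] k = x [^] (1::int)"
    using int_pow_eq x_carr by blast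
  then show ?thesis
    using h_x x_carr by simp
qed

lemma cyclic_factor_iff:
  assumes K: "K \<lhd> (G\<lparr>carrier := H\<rparr>)" and H: "subgroup H G"
  shows "cyclic_group ((G\<lparr>carrier := H\<rparr>) Mod K) \<longleftrightarrow>
    (\<exists>a\<in>H. \<forall>x\<in>H. \<exists>n::int. K #> x = K #> (a [^] n))"
proof -
  let ?Q = "(G\<lparr>carrier := H\<rparr>) Mod K"
  have Q: "group ?Q"
    using K by (rule normal.factorgroup_is_group)
  have carr: "carrier ?Q = (\<lambda>x. K #> x) ` H"
    by (simp add: carrier_FactGroup)
  have pow: "(K #> a) [^]\<^bsub>?Q\<^esub> n = K #> (a [^] n)" if "a \<in> H" for a and n :: int
    using normal.FactGroup_int_pow[OF K, of a n] that int_pow_consistent[OF H that] by simp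
  have pow_mem: "a [^] n \<in> H" if "a \<in> H" for a and n :: int
    using H that by (rule subgroup_int_pow_closed)
  have "cyclic_group ?Q \<longleftrightarrow> (\<exists>a\<in>H. carrier ?Q = range (\<lambda>n::int. K #> (a [^] n)))"
    unfolding group.cyclic_group[OF Q] using pow by (auto simp: carr)
  also have "\<dots> \<longleftrightarrow> (\<exists>a\<in>H. carrier ?Q \<subseteq> range (\<lambda>n::int. K #> (a [^] n)))"
  proof (rule bex_cong[OF refl])
    fix a assume "a \<in> H"
    then have "range (\<lambda>n::int. K #> (a [^] n)) \<subseteq> carrier ?Q"
      using pow_mem by (auto simp: carr)
    then show "carrier ?Q = range (\<lambda>n::int. K #> (a [^] n)) \<longleftrightarrow> carrier ?Q \<subseteq> range (\<lambda>n::int. K #> (a [^] n))"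
      by (metis subset_antisym subset_refl)
  qed
  also have "\<dots> \<longleftrightarrow> (\<exists>a\<in>H. \<forall>x\<in>H. \<exists>n::int. K #> x = K #> (a [^] n))"
    unfolding carr by (intro bex_cong refl) blast
  finally show ?thesis .
qed

lemma supersolvable_seq_normal: "supersolvable_seq G H \<Longrightarrow> H \<lhd> G"
  by (erule supersolvable_seq.cases) (simp_all add: one_is_normal)

text \<open>In a supersolvable group, elements of \<open>q\<close>-power order centralize normal \<open>p\<close>-subgroups if \<open>q > p\<close>. The
  induction climbs the series. If \<open>d\<close> lies in the next term, then its image in the cyclic factor is
  fixed by \<open>h\<close>, so \<open>h d h\<^sup>-\<^sup>1 = c d\<close> where \<open>c\<close> lies in \<open>D\<close> and in the previous term. By induction \<open>c\<close>
  commutes with \<open>h\<close>, so \<open>h\<^sup>m d h\<^sup>-\<^sup>m = c\<^sup>m d\<close>; hence the order of \<open>c\<close> divides a power of \<open>q\<close>, as well as a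
  power of \<open>p\<close>.\<close>

lemma supersolvable_seq_centralizes:
  fixes p q i j :: nat
  assumes seq: "supersolvable_seq G H" and D: "D \<lhd> G" and D_pow: "\<And>d. d \<in> D \<Longrightarrow> d [^] (p ^ i) = \<one>"
    and h: "h \<in> carrier G" "h [^] (q ^ j) = \<one>" and p: "prime p" and q: "prime q" and pq: "p < q"
  shows "d \<in> D \<inter> H \<Longrightarrow> h \<otimes> d = d \<otimes> h"
  using seq
proof (induction arbitrary: d rule: supersolvable_seq.induct)
  case unity
  then show ?case
    using h by auto
next
  case (extension K H)
  interpret D: normal D G by (rule D)
  interpret K: normal K G using supersolvable_seq_normal extension.hyps(1) .
  interpret H: normal H G using extension.hyps(3) .
  let ?Q = "G Mod K"
  interpret Q: group ?Q by (rule K.factorgroup_is_group)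
  interpret \<pi>: group_hom G ?Q "\<lambda>x. K #> x"
    using K.r_coset_hom_Mod by unfold_locales
  obtain a where a: "a \<in> H" "\<And>x. x \<in> H \<Longrightarrow> \<exists>n::int. K #> x = K #> (a [^] n)"
    using extension.hyps(4) cyclic_factor_iff[OF extension.hyps(2) H.subgroup_axioms] by blast
  have d: "d \<in> D" "d \<in> H" "d \<in> carrier G"
    using extension.prems by auto
  obtain n :: int where n: "K #> d = K #> (a [^] n)"
    using a d by blast
  obtain k :: int where k: "K #> (h \<otimes> a \<otimes> inv h) = K #> (a [^] k)"
    using a(2)[of "h \<otimes> a \<otimes> inv h"] a(1) h H.inv_op_closed2 by blast
  have "(K #> h) \<otimes>\<^bsub>?Q\<^esub> (K #> d) \<otimes>\<^bsub>?Q\<^esub> inv\<^bsub>?Q\<^esub> (K #> h) = K #> d"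
  proof (rule Q.prime_power_fixes_cyclic_prime_power[OF _ _ _ _ _ _ p q pq])
    show "(K #> h) \<otimes>\<^bsub>?Q\<^esub> (K #> a) \<otimes>\<^bsub>?Q\<^esub> inv\<^bsub>?Q\<^esub> (K #> h) = (K #> a) [^]\<^bsub>?Q\<^esub> k"
      using k a(1) h(1) by (simp add: \<pi>.hom_mult[symmetric] \<pi>.hom_inv[symmetric] \<pi>.hom_int_pow[symmetric] del: \<pi>.hom_mult \<pi>.hom_inv mult_FactGroup)
    show "K #> d = (K #> a) [^]\<^bsub>?Q\<^esub> n"
      using n a(1) by (simp add: \<pi>.hom_int_pow[symmetric])
    show "(K #> d) [^]\<^bsub>?Q\<^esub> (p ^ i) = \<one>\<^bsub>?Q\<^esub>"
      using D_pow[OF d(1)] d(3) \<pi>.hom_nat_pow[of d "p ^ i"] \<pi>.hom_one by simp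
    show "(K #> h) [^]\<^bsub>?Q\<^esub> (q ^ j) = \<one>\<^bsub>?Q\<^esub>"
      using h \<pi>.hom_nat_pow[of h "q ^ j"] \<pi>.hom_one by simp
  qed (use a(1) h(1) in \<open>auto simp del: carrier_FactGroup\<close>)
  then have "K #> (h \<otimes> d \<otimes> inv h) = K #> d"
    using d(3) h(1) by (simp add: \<pi>.hom_mult[symmetric] \<pi>.hom_inv[symmetric] del: \<pi>.hom_mult \<pi>.hom_inv mult_FactGroup)
  define c where "c = h \<otimes> d \<otimes> inv h \<otimes> inv d"
  have "h \<otimes> d \<otimes> inv h \<in> K #> d"
    using \<open>K #> (h \<otimes> d \<otimes> inv h) = K #> d\<close> d(3) h(1) rcos_self[OF _ K.subgroup_axioms, of "h \<otimes> d \<otimes> inv h"]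
    by simp
  then have "c \<in> K"
    using K.rcos_module[OF is_group d(3), of "h \<otimes> d \<otimes> inv h"] d(3) h(1) by (simp add: c_def)
  have "c \<in> D"
    unfolding c_def using d h(1) D.inv_op_closed2 by (simp add: D.m_closed)
  have c_carr: "c \<in> carrier G"
    using \<open>c \<in> K\<close> by simp
  have "h \<otimes> c = c \<otimes> h"
    using extension.IH \<open>c \<in> K\<close> \<open>c \<in> D\<close> by blast
  then have c_fix: "h \<otimes> c [^] m \<otimes> inv h = c [^] m" for m :: nat
    using c_carr h(1) by (metis group_commutes_pow inv_solve_right' m_closed nat_pow_closed nat_pow_Suc)
  have h_d: "h \<otimes> d \<otimes> inv h = c \<otimes> d"
    using d(3) h(1) by (simp add: c_def m_assoc)
  have iter: "h [^] m \<otimes> d \<otimes> inv (h [^] m) = c [^] m \<otimes> d" for m :: nat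
  proof (induction m)
    case 0
    then show ?case
      using d by simp
  next
    case (Suc m)
    have "h [^] Suc m = h \<otimes> h [^] m"
      using h nat_pow_Suc2 by blast
    then have "h [^] Suc m \<otimes> d \<otimes> inv (h [^] Suc m) = h \<otimes> (h [^] m \<otimes> d \<otimes> inv (h [^] m)) \<otimes> inv h"
      using h d by (simp add: conj_mult)
    also have "\<dots> = h \<otimes> (c [^] m \<otimes> d) \<otimes> inv h"
      using Suc.IH by simp
    also have "\<dots> = c [^] m \<otimes> (c \<otimes> d)"
      using conj_hom[of h "c [^] m" d] h(1) c_carr d(3) c_fix h_d by simp
    finally show ?case
      using c_carr d(3) by (simp add: m_assoc)
  qed
  have "c [^] (q ^ j) = \<one>"
    using iter[of "q ^ j"] h d(3) c_carr by (simp add: r_cancel_one')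
  then have "ord c dvd q ^ j"
    using pow_eq_id c_carr by blast
  moreover have "ord c dvd p ^ i"
    using D_pow[OF \<open>c \<in> D\<close>] pow_eq_id c_carr by blast
  moreover have "coprime (p ^ i) (q ^ j)"
    using p q pq primes_coprime by auto
  ultimately have "ord c = 1"
    by (metis coprime_common_divisor_nat)
  then have "c = \<one>"
    using ord_eq_1 c_carr by blast
  then show ?case
    using h_d h(1) d(3) by (metis inv_solve_right' l_one m_closed)
qed

end

section \<open>Sylow subgroups and normalizers of p-subgroups\<close>

definition sylow_subgroup :: "('a, 'b) monoid_scheme \<Rightarrow> nat \<Rightarrow> 'a set \<Rightarrow> bool"
  where "sylow_subgroup G p P \<longleftrightarrow> subgroup P G \<and> card P = p ^ multiplicity p (order G)"

definition centralizes :: "('a, 'b) monoid_scheme \<Rightarrow> 'a \<Rightarrow> 'a set \<Rightarrow> bool"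
  where "centralizes G c D \<longleftrightarrow> (\<forall>d\<in>D. c \<otimes>\<^bsub>G\<^esub> d = d \<otimes>\<^bsub>G\<^esub> c)"

context group
begin

lemma card_subgroup_dvd:
  assumes "finite (carrier G)" "subgroup H G" "subgroup K G" "H \<subseteq> K"
  shows "card H dvd card K"
proof -
  interpret K: group "G\<lparr>carrier := K\<rparr>"
    using assms subgroup_imp_group by blast
  have "subgroup H (G\<lparr>carrier := K\<rparr>)"
    using assms subgroup_incl by blast
  then have "card (rcosets\<^bsub>G\<lparr>carrier := K\<rparr>\<^esub> H) * card H = card K"
    using K.lagrange[of H] by (simp add: order_def)
  then show ?thesis
    by (metis dvd_triv_right)
qed

lemma sylow_subgroup_exists:
  assumes "finite (carrier G)" "prime p"
  shows "\<exists>P. sylow_subgroup G p P"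
proof -
  have "order G \<noteq> 0"
    using assms by (simp add: order_gt_0_iff_finite[symmetric])
  obtain m where "order G = p ^ multiplicity p (order G) * m"
    using multiplicity_dvd[of p "order G"] by blast
  then show ?thesis
    using sylow_thm[OF assms(2) is_group _ assms(1)] by (auto simp: sylow_subgroup_def)
qed

lemma sylow_index_not_dvd:
  assumes fin: "finite (carrier G)" and p: "prime p" and P: "sylow_subgroup G p P"
  shows "\<not> p dvd card (rcosets P)"
proof
  assume "p dvd card (rcosets P)"
  then have "p ^ Suc (multiplicity p (order G)) dvd order G"
    using lagrange[of P] P unfolding sylow_subgroup_def
    by (metis mult_dvd_mono dvd_refl power_Suc)
  moreover have "order G \<noteq> 0"
    using fin by (simp add: order_gt_0_iff_finite[symmetric])
  ultimately show False
    using p by (metis power_dvd_iff_le_multiplicity not_less_eq_eq order_refl not_prime_unit)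
qed

lemma sylow_conj_set:
  "sylow_subgroup G p P \<Longrightarrow> g \<in> carrier G \<Longrightarrow> sylow_subgroup G p (conj_set G g P)"
  by (simp add: sylow_subgroup_def conj_set_subgroup card_conj_set subgroup.subset)

lemma p_subgroup_le_conj_sylow:
  assumes fin: "finite (carrier G)" and p: "prime p" and P: "sylow_subgroup G p P"
    and Q: "subgroup Q G" "card Q = p ^ k"
  shows "\<exists>g\<in>carrier G. Q \<subseteq> conj_set G g P"
proof -
  have P_sub: "subgroup P G"
    using P by (simp add: sylow_subgroup_def)
  obtain g where g: "g \<in> carrier G" "\<And>x. x \<in> Q \<Longrightarrow> g \<otimes> x \<otimes> inv g \<in> P"
    using p_subgroup_conj_into_sylow[OF fin p P_sub sylow_index_not_dvd[OF fin p P] Q] by blast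
  have "x \<in> conj_set G (inv g) P" if "x \<in> Q" for x
    using mem_conj_set_iff[OF subgroup.subset[OF P_sub], of "inv g" x] g that
      subgroup.mem_carrier[OF Q(1) that] by simp
  then show ?thesis
    using g(1) by blast
qed

lemma p_subgroup_le_sylow:
  assumes fin: "finite (carrier G)" and p: "prime p" and Q: "subgroup Q G" "card Q = p ^ k"
  obtains P where "sylow_subgroup G p P" "Q \<subseteq> P"
proof -
  obtain P where P: "sylow_subgroup G p P"
    using sylow_subgroup_exists fin p by blast
  then show ?thesis
    using p_subgroup_le_conj_sylow[OF fin p P Q] sylow_conj_set that by blast
qed

lemma sylow_subgroups_conj:
  assumes fin: "finite (carrier G)" and p: "prime p" and P: "sylow_subgroup G p P" and Q: "sylow_subgroup G p Q"
  shows "\<exists>g\<in>carrier G. Q = conj_set G g P"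
proof -
  obtain g where g: "g \<in> carrier G" "Q \<subseteq> conj_set G g P"
    using p_subgroup_le_conj_sylow[OF fin p P] Q unfolding sylow_subgroup_def by blast
  have "sylow_subgroup G p (conj_set G g P)"
    using sylow_conj_set P g by blast
  then have "card (conj_set G g P) = card Q" "conj_set G g P \<subseteq> carrier G"
    using Q by (auto simp: sylow_subgroup_def subgroup.subset)
  then have "Q = conj_set G g P"
    using g(2) fin by (metis card_subset_eq finite_subset)
  then show ?thesis
    using g by blast
qed

text \<open>The order of \<open>K\<close> is divisible by the full power of each prime that occurs in the order of the group.\<close>

lemma subgroup_containing_sylows_eq_carrier:
  assumes fin: "finite (carrier G)" and K: "subgroup K G"
    and sylows: "\<And>q. prime q \<Longrightarrow> \<exists>Y\<subseteq>K. sylow_subgroup G q Y"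
  shows "K = carrier G"
proof -
  have K_sub: "K \<subseteq> carrier G"
    using K by (rule subgroup.subset)
  then have K_pos: "card K \<noteq> 0"
    using subgroup.finite_imp_card_positive[OF K fin] by simp
  have "order G dvd card K"
  proof (rule multiplicity_le_imp_dvd)
    fix q :: nat assume q: "prime q"
    obtain Y where Y: "Y \<subseteq> K" "subgroup Y G" "card Y = q ^ multiplicity q (order G)"
      using sylows[OF q] by (auto simp: sylow_subgroup_def)
    then have "q ^ multiplicity q (order G) dvd card K"
      using card_subgroup_dvd[OF fin _ K] by metis
    then show "multiplicity q (order G) \<le> multiplicity q (card K)"
      using q K_pos by (intro multiplicity_geI) auto
  qed (use fin in \<open>simp add: order_gt_0_iff_finite[symmetric]\<close>)
  then have "card (carrier G) \<le> card K"
    using K_pos by (auto simp: order_def dest: dvd_imp_le)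
  then show ?thesis
    using K_sub fin by (simp add: card_seteq)
qed

lemma mem_normalizer_iff:
  assumes "D \<subseteq> carrier G"
  shows "g \<in> normalizer G D \<longleftrightarrow> g \<in> carrier G \<and> conj_set G g D = D"
proof -
  have "g <# D #> inv g = conj_set G g D"
    by (auto simp: conj_set_def l_coset_def r_coset_def)
  then show ?thesis
    using assms by (simp add: normalizer_def stabilizer_def)
qed

lemma subgroup_le_normalizer:
  assumes "subgroup D G" shows "D \<subseteq> normalizer G D"
  using normal_imp_subgroup[OF subgroup_in_normalizer[OF assms]] subgroup.subset by fastforce

lemma normalizerI_finite:
  assumes D: "D \<subseteq> carrier G" "finite D" and g: "g \<in> carrier G" "\<And>d. d \<in> D \<Longrightarrow> g \<otimes> d \<otimes> inv g \<in> D"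
  shows "g \<in> normalizer G D"
proof -
  have "conj_set G g D \<subseteq> D"
    using g by (auto simp: conj_set_def)
  then have "conj_set G g D = D"
    using D g card_conj_set by (metis card_subset_eq)
  then show ?thesis
    using mem_normalizer_iff D g by blast
qed

lemma centralizes_mult:
  assumes "c \<in> carrier G" "c' \<in> carrier G" "D \<subseteq> carrier G" "centralizes G c D" "centralizes G c' D"
  shows "centralizes G (c \<otimes> c') D"
  unfolding centralizes_def
proof
  fix d assume d: "d \<in> D"
  then have d_carr: "d \<in> carrier G"
    using assms by blast
  have "c \<otimes> c' \<otimes> d = c \<otimes> (d \<otimes> c')"
    using assms d d_carr by (simp add: m_assoc centralizes_def)
  also have "\<dots> = (d \<otimes> c) \<otimes> c'"
    using assms d d_carr by (simp add: m_assoc[symmetric] centralizes_def)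
  finally show "c \<otimes> c' \<otimes> d = d \<otimes> (c \<otimes> c')"
    using assms d_carr by (simp add: m_assoc)
qed

lemma centralizes_conj:
  assumes "c \<in> carrier G" "d \<in> carrier G" "c \<otimes> d = d \<otimes> c"
  shows "c \<otimes> d \<otimes> inv c = d"
  using assms by (simp add: m_assoc)

lemma centralizer_in_normalizer:
  assumes D: "subgroup D G"
  defines "C \<equiv> {c \<in> normalizer G D. centralizes G c D}"
  shows "C \<lhd> (G\<lparr>carrier := normalizer G D\<rparr>)"
proof -
  let ?N = "normalizer G D"
  have D_sub: "D \<subseteq> carrier G"
    using D by (rule subgroup.subset)
  have N: "subgroup ?N G"
    using normalizer_imp_subgroup[OF D_sub] .
  have N_carr: "n \<in> carrier G" if "n \<in> ?N" for n
    using subgroup.mem_carrier[OF N that] .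
  interpret N: group "G\<lparr>carrier := ?N\<rparr>"
    using N subgroup_imp_group by blast
  have inv_cent: "centralizes G (inv c) D" if c: "c \<in> carrier G" "centralizes G c D" for c
    unfolding centralizes_def
  proof
    fix d assume d: "d \<in> D"
    then have d_carr: "d \<in> carrier G"
      using D_sub by blast
    have "c \<otimes> d = d \<otimes> c"
      using c d by (simp add: centralizes_def)
    then have "d \<otimes> inv c = inv c \<otimes> (d \<otimes> c) \<otimes> inv c"
      using c(1) d_carr by (metis inv_closed inv_solve_left m_assoc m_closed)
    then show "inv c \<otimes> d = d \<otimes> inv c"
      using c(1) d_carr by (simp add: m_assoc)
  qed
  have conj_cent: "centralizes G (n \<otimes> c \<otimes> inv n) D" if n: "n \<in> ?N" and c: "c \<in> carrier G" "centralizes G c D" for n c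
    unfolding centralizes_def
  proof
    fix d assume d: "d \<in> D"
    have n_carr: "n \<in> carrier G" and "conj_set G n D = D"
      using mem_normalizer_iff[OF D_sub] n by auto
    then obtain e where e: "e \<in> D" "d = n \<otimes> e \<otimes> inv n"
      using d unfolding conj_set_def by blast
    have e_carr: "e \<in> carrier G"
      using e D_sub by blast
    have "c \<otimes> e = e \<otimes> c"
      using c e by (simp add: centralizes_def)
    then have "n \<otimes> (c \<otimes> e) \<otimes> inv n = n \<otimes> (e \<otimes> c) \<otimes> inv n"
      by simp
    then show "n \<otimes> c \<otimes> inv n \<otimes> d = d \<otimes> (n \<otimes> c \<otimes> inv n)"
      using conj_hom n_carr c(1) e_carr e(2) by simp
  qed
  have "subgroup C G"
  proof (rule subgroupI)
    have "centralizes G \<one> D"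
      using D_sub unfolding centralizes_def by (metis l_one r_one subsetD)
    then show "C \<noteq> {}"
      using subgroup.one_closed[OF N] by (auto simp: C_def)
  next
    fix a b assume "a \<in> C" "b \<in> C"
    then show "a \<otimes> b \<in> C"
      using centralizes_mult[OF _ _ D_sub] N_carr subgroup.m_closed[OF N] by (auto simp: C_def)
  next
    fix a assume "a \<in> C"
    then show "inv a \<in> C"
      using inv_cent N_carr subgroup.m_inv_closed[OF N] by (auto simp: C_def)
  qed (use N_carr in \<open>auto simp: C_def\<close>)
  then have "subgroup C (G\<lparr>carrier := ?N\<rparr>)"
    by (rule subgroup_incl[OF _ N]) (auto simp: C_def)
  then show ?thesis
  proof (rule N.normal_invI)
    fix n c assume "n \<in> carrier (G\<lparr>carrier := ?N\<rparr>)" and "c \<in> C"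
    then have n: "n \<in> ?N" and c: "c \<in> ?N" "centralizes G c D"
      by (auto simp: C_def)
    then have "n \<otimes> c \<otimes> inv n \<in> C"
      using conj_cent N_carr subgroup.m_closed[OF N] subgroup.m_inv_closed[OF N] by (auto simp: C_def)
    then show "n \<otimes>\<^bsub>G\<lparr>carrier := ?N\<rparr>\<^esub> c \<otimes>\<^bsub>G\<lparr>carrier := ?N\<rparr>\<^esub> inv\<^bsub>G\<lparr>carrier := ?N\<rparr>\<^esub> n \<in> C"
      using n m_inv_consistent[OF N n] by simp
  qed
qed

text \<open>The factorization \<open>N(D) = C(D) R\<close> for a Sylow \<open>p\<close>-subgroup \<open>R\<close> of the normalizer. The right-hand side
  is a subgroup because \<open>C(D)\<close> is normal in \<open>N(D)\<close>. It contains \<open>R\<close>, and for each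
  prime \<open>q \<noteq> p\<close> the centralizer already contains the Sylow \<open>q\<close>-subgroups.\<close>

lemma normalizer_eq_centralizer_sylow:
  fixes p :: nat
  assumes fin: "finite (carrier G)" and p: "prime p" and D: "subgroup D G"
    and coprime_central: "\<And>q j h. \<lbrakk>prime q; q \<noteq> p; h \<in> normalizer G D; h [^] (q ^ j :: nat) = \<one>\<rbrakk> \<Longrightarrow> centralizes G h D"
    and R: "sylow_subgroup (G\<lparr>carrier := normalizer G D\<rparr>) p R" and n: "n \<in> normalizer G D"
  shows "\<exists>c r. c \<in> normalizer G D \<and> centralizes G c D \<and> r \<in> R \<and> n = c \<otimes> r"
proof -
  let ?N = "normalizer G D" and ?GN = "G\<lparr>carrier := normalizer G D\<rparr>"
  define C where "C = {c \<in> ?N. centralizes G c D}"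
  have N: "subgroup ?N G"
    using normalizer_imp_subgroup[OF subgroup.subset[OF D]] .
  interpret N: group ?GN
    using N subgroup_imp_group by blast
  have finN: "finite (carrier ?GN)"
    using fin subgroup.subset[OF N] finite_subset by auto
  have C: "C \<lhd> ?GN"
    using centralizer_in_normalizer[OF D] by (simp add: C_def)
  have C_sub: "subgroup C ?GN"
    using C by (rule normal_imp_subgroup)
  have R_sub: "subgroup R ?GN"
    using R by (simp add: sylow_subgroup_def)
  have "C <#>\<^bsub>?GN\<^esub> R = carrier ?GN"
  proof (rule N.subgroup_containing_sylows_eq_carrier[OF finN])
    show "subgroup (C <#>\<^bsub>?GN\<^esub> R) ?GN"
      using N.mult_norm_subgroup C R_sub by blast
    fix q :: nat assume q: "prime q"
    show "\<exists>Y\<subseteq>C <#>\<^bsub>?GN\<^esub> R. sylow_subgroup ?GN q Y"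
    proof (cases "q = p")
      case True
      have "r \<in> C <#>\<^bsub>?GN\<^esub> R" if r: "r \<in> R" for r
      proof -
        have "\<one> \<otimes> r \<in> C <#>\<^bsub>?GN\<^esub> R"
          using subgroup.one_closed[OF C_sub] r unfolding set_mult_def by auto
        then show ?thesis
          using subgroup.mem_carrier[OF incl_subgroup[OF N R_sub] r] by simp
      qed
      then show ?thesis
        using R True by blast
    next
      case False
      obtain Y where Y: "sylow_subgroup ?GN q Y"
        using N.sylow_subgroup_exists[OF finN q] by blast
      then have Y_sub: "subgroup Y ?GN" "card Y = q ^ multiplicity q (order ?GN)"
        by (auto simp: sylow_subgroup_def)
      have "y \<in> C <#>\<^bsub>?GN\<^esub> R" if y: "y \<in> Y" for y
      proof -
        have yN: "y \<in> ?N"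
          using subgroup.mem_carrier[OF Y_sub(1) y] by simp
        have Y_G: "subgroup Y G"
          using incl_subgroup[OF N Y_sub(1)] .
        interpret Y: group "G\<lparr>carrier := Y\<rparr>"
          using Y_G subgroup_imp_group by blast
        have "y [^] (q ^ multiplicity q (order ?GN)) = \<one>"
          using Y.pow_order_eq_1[of y] y Y_sub(2) by (simp add: order_def nat_pow_consistent[symmetric])
        then have "y \<in> C"
          using coprime_central[OF q False yN] yN by (simp add: C_def)
        then have "y \<otimes> \<one> \<in> C <#>\<^bsub>?GN\<^esub> R"
          using subgroup.one_closed[OF R_sub] unfolding set_mult_def by auto
        then show ?thesis
          using subgroup.mem_carrier[OF N yN] by simp
      qed
      then show ?thesis
        using Y by blast
    qed
  qed
  then have "n \<in> C <#>\<^bsub>?GN\<^esub> R"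
    using n by simp
  then show ?thesis
    by (auto simp: set_mult_def C_def)
qed

end

section \<open>Control of fusion\<close>

context group
begin

text \<open>Sylow's conjugacy theorem with control over the conjugating element, the core of Frobenius'
  theorem on normal \<open>p\<close>-complements. The last hypothesis says that \<open>N(D) / C(D)\<close> is a \<open>p\<close>-group for
  nontrivial \<open>p\<close>-subgroups \<open>D\<close>. Let \<open>D = P \<inter> Q\<close>; the induction goes from large to small \<open>D\<close>. The
  normalizer of \<open>D\<close> meets both \<open>P\<close> and \<open>Q\<close> in more than \<open>D\<close>. Inside it, some \<open>c\<close> that centralizes \<open>D\<close>
  carries a Sylow subgroup \<open>R\<close> of \<open>N(D)\<close> containing \<open>N(D) \<inter> P\<close> to one containing \<open>N(D) \<inter> Q\<close>. If \<open>P1\<close> is a Sylow subgroup of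
  the whole group above \<open>R\<close>, then the induction hypothesis applies to \<open>P, P1\<close> and to \<open>c P1 c\<^sup>-\<^sup>1, Q\<close>.\<close>

lemma sylow_conj_by_centralizer_of_inter:
  fixes p :: nat
  assumes fin: "finite (carrier G)" and p: "prime p"
    and coprime_central: "\<And>D q j h. \<lbrakk>subgroup D G; D \<noteq> {\<one>}; \<exists>i. card D = p ^ i; prime q; q \<noteq> p;
      h \<in> normalizer G D; h [^] (q ^ j :: nat) = \<one>\<rbrakk> \<Longrightarrow> centralizes G h D"
  shows "sylow_subgroup G p P \<Longrightarrow> sylow_subgroup G p Q \<Longrightarrow>
    \<exists>c\<in>carrier G. centralizes G c (P \<inter> Q) \<and> Q = conj_set G c P"
proof (induction "card P - card (P \<inter> Q)" arbitrary: P Q rule: less_induct)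
  case less
  have P: "subgroup P G" "card P = p ^ multiplicity p (order G)"
    and Q: "subgroup Q G" "card Q = p ^ multiplicity p (order G)"
    using less.prems by (auto simp: sylow_subgroup_def)
  have P_sub: "P \<subseteq> carrier G" and Q_sub: "Q \<subseteq> carrier G"
    using P Q subgroup.subset by auto
  have finP: "finite P" and finQ: "finite Q"
    using P_sub Q_sub fin finite_subset by auto
  define D where "D = P \<inter> Q"
  have D: "subgroup D G"
    unfolding D_def using P Q subgroups_Inter_pair by blast
  have D_sub: "D \<subseteq> carrier G"
    using D subgroup.subset by blast
  \<comment> \<open>The centralizer condition is automatic for trivial \<open>D\<close>, which is not covered by the
    hypothesis on normalizers.\<close>
  consider "D = {\<one>}" | "P = Q" | "D \<noteq> {\<one>}" "P \<noteq> Q"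
    by blast
  then show ?case
  proof cases
    case 1
    then obtain g where g: "g \<in> carrier G" "Q = conj_set G g P"
      using sylow_subgroups_conj[OF fin p less.prems] by auto
    moreover have "centralizes G g D"
      using 1 g by (simp add: centralizes_def)
    ultimately show ?thesis
      unfolding D_def by blast
  next
    case 2
    have "centralizes G \<one> (P \<inter> Q)"
      unfolding centralizes_def using P_sub by auto
    moreover have "Q = conj_set G \<one> P"
      using 2 P_sub by (simp add: conj_set_one)
    ultimately show ?thesis
      by blast
  next
    case 3
    have card_D: "\<exists>i. card D = p ^ i"
    proof -
      have "card D dvd card P"
        using card_subgroup_dvd[OF fin D P(1)] by (simp add: D_def)
      then show ?thesis
        unfolding P(2) divides_primepow_nat[OF p] by blast
    qed
    let ?N = "normalizer G D"
    have N: "subgroup ?N G"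
      using normalizer_imp_subgroup[OF D_sub] .
    have finN: "finite (carrier (G\<lparr>carrier := ?N\<rparr>))"
      using fin subgroup.subset[OF N] finite_subset by auto
    interpret N: group "G\<lparr>carrier := ?N\<rparr>"
      using N subgroup_imp_group by blast
    have N_carr: "?N \<subseteq> carrier G"
      using N subgroup.subset by blast
    have grows: "card D < card (?N \<inter> S)"
      if S: "subgroup S G" "card S = p ^ multiplicity p (order G)" "D \<subseteq> S" "D \<noteq> S" for S
    proof -
      interpret S: group "G\<lparr>carrier := S\<rparr>"
        using S(1) subgroup_imp_group by blast
      have finS: "finite S"
        using S(1) fin finite_subset subgroup.subset by blast
      have "subgroup D (G\<lparr>carrier := S\<rparr>)"
        using subgroup_incl D S by blast
      then have "\<exists>x\<in>S - D. \<forall>d\<in>D. x \<otimes> d \<otimes> inv\<^bsub>G\<lparr>carrier := S\<rparr>\<^esub> x \<in> D"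
        using S.p_group_normalizer_grows[of p "multiplicity p (order G)" D] S(2,4) p
        by (simp add: order_def[of "G\<lparr>carrier := S\<rparr>"])
      then obtain x where x: "x \<in> S" "x \<notin> D" "\<And>d. d \<in> D \<Longrightarrow> x \<otimes> d \<otimes> inv x \<in> D"
        using m_inv_consistent[OF S(1)] by auto
      have "x \<in> carrier G"
        using subgroup.mem_carrier[OF S(1) x(1)] .
      then have "x \<in> ?N"
        using normalizerI_finite[OF D_sub finite_subset[OF D_sub fin]] x(3) by blast
      moreover have "D \<subseteq> ?N"
        using subgroup_le_normalizer[OF D] .
      ultimately have "D \<subset> ?N \<inter> S"
        using x S by blast
      then show ?thesis
        using finS by (simp add: psubset_card_mono)
    qed
    have inter_sub: "subgroup (?N \<inter> S) (G\<lparr>carrier := ?N\<rparr>)" "\<exists>i. card (?N \<inter> S) = p ^ i"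
      if S: "subgroup S G" "card S = p ^ multiplicity p (order G)" for S
    proof -
      have NS: "subgroup (?N \<inter> S) G"
        using N S subgroups_Inter_pair by blast
      then show "subgroup (?N \<inter> S) (G\<lparr>carrier := ?N\<rparr>)"
        using subgroup_incl[OF _ N] by blast
      have "card (?N \<inter> S) dvd card S"
        using card_subgroup_dvd[OF fin NS S(1)] by simp
      then show "\<exists>i. card (?N \<inter> S) = p ^ i"
        unfolding S(2) divides_primepow_nat[OF p] by blast
    qed
    have D_neq: "D \<noteq> P" "D \<noteq> Q"
      using 3 finP finQ P(2) Q(2) card_subset_eq unfolding D_def by (metis inf_le1 inf_le2)+
    obtain R where R: "sylow_subgroup (G\<lparr>carrier := ?N\<rparr>) p R" "?N \<inter> P \<subseteq> R"
      using N.p_subgroup_le_sylow[OF finN p] inter_sub[OF P] by metis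
    have R_sub: "subgroup R (G\<lparr>carrier := ?N\<rparr>)" "card R = p ^ multiplicity p (order (G\<lparr>carrier := ?N\<rparr>))"
      using R by (auto simp: sylow_subgroup_def)
    have R_G: "subgroup R G"
      using incl_subgroup[OF N R_sub(1)] .
    obtain j where j: "card (?N \<inter> Q) = p ^ j"
      using inter_sub(2)[OF Q] by blast
    obtain n where n: "n \<in> ?N" "?N \<inter> Q \<subseteq> conj_set (G\<lparr>carrier := ?N\<rparr>) n R"
      using N.p_subgroup_le_conj_sylow[OF finN p R(1) inter_sub(1)[OF Q] j] by auto
    have "conj_set (G\<lparr>carrier := ?N\<rparr>) n R = conj_set G n R"
      using m_inv_consistent[OF N n(1)] by (simp add: conj_set_def)
    then have n_R: "?N \<inter> Q \<subseteq> conj_set G n R"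
      using n by simp
    \<comment> \<open>The factor \<open>r\<close> normalizes \<open>R\<close>, so \<open>n\<close> may be replaced by \<open>c\<close>.\<close>
    obtain c r where c: "c \<in> ?N" "centralizes G c D" and r: "r \<in> R" and n_eq: "n = c \<otimes> r"
      using normalizer_eq_centralizer_sylow[OF fin p D _ R(1) n(1)] coprime_central D 3(1) card_D by blast
    have c_carr: "c \<in> carrier G" and r_carr: "r \<in> carrier G"
      using c N_carr r subgroup.mem_carrier[OF R_G] by auto
    have R_carr: "R \<subseteq> carrier G"
      using R_G subgroup.subset by blast
    have "conj_set G r R \<subseteq> R"
      unfolding conj_set_def using r R_G
      by (auto intro!: subgroup.m_closed[OF R_G] subgroup.m_inv_closed[OF R_G])
    moreover have "conj_set G n R = conj_set G c (conj_set G r R)"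
      using conj_set_mult R_carr c_carr r_carr n_eq by simp
    ultimately have c_R: "?N \<inter> Q \<subseteq> conj_set G c R"
      using n_R conj_set_mono[of "conj_set G r R" R c] by simp
    obtain P1 where P1: "sylow_subgroup G p P1" "R \<subseteq> P1"
      using p_subgroup_le_sylow[OF fin p R_G R_sub(2)] .
    have P1': "subgroup P1 G" "card P1 = p ^ multiplicity p (order G)"
      using P1 by (auto simp: sylow_subgroup_def)
    define P2 where "P2 = conj_set G c P1"
    have P2: "sylow_subgroup G p P2"
      unfolding P2_def using sylow_conj_set P1 c_carr by blast
    have P2': "subgroup P2 G" "card P2 = p ^ multiplicity p (order G)"
      using P2 by (auto simp: sylow_subgroup_def)
    have finP2: "finite P2"
      using finite_subset[OF subgroup.subset[OF P2'(1)] fin] .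
    have NP: "?N \<inter> P \<subseteq> P \<inter> P1" and NQ: "?N \<inter> Q \<subseteq> P2 \<inter> Q"
      using R(2) P1(2) c_R conj_set_mono[OF P1(2), of c] by (auto simp: P2_def)
    have D_N: "D \<subseteq> ?N"
      using subgroup_le_normalizer[OF D] .
    have D_le: "D \<subseteq> P \<inter> P1" "D \<subseteq> P2 \<inter> Q"
      using D_N NP NQ by (auto simp: D_def)
    have "card D < card (P \<inter> P1)"
      using grows[OF P _ D_neq(1)] card_mono[OF _ NP] finP by (auto simp: D_def)
    moreover have "card (P \<inter> P1) \<le> card P"
      using finP by (simp add: card_mono)
    ultimately have "card P - card (P \<inter> P1) < card P - card (P \<inter> Q)"
      by (simp add: D_def)
    then obtain c1 where c1: "c1 \<in> carrier G" "centralizes G c1 (P \<inter> P1)" "P1 = conj_set G c1 P"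
      using less.hyps less.prems(1) P1(1) by blast
    have "card D < card (P2 \<inter> Q)"
      using grows[OF Q _ D_neq(2)] card_mono[OF _ NQ] finP2 by (auto simp: D_def)
    moreover have "card (P2 \<inter> Q) \<le> card P2"
      using finP2 by (simp add: card_mono)
    ultimately have "card P2 - card (P2 \<inter> Q) < card P - card (P \<inter> Q)"
      using P2'(2) P(2) by (simp add: D_def)
    then obtain c2 where c2: "c2 \<in> carrier G" "centralizes G c2 (P2 \<inter> Q)" "Q = conj_set G c2 P2"
      using less.hyps P2 less.prems(2) by blast
    have "Q = conj_set G (c2 \<otimes> (c \<otimes> c1)) P"
      using c2 c1 c_carr P_sub P2_def by (simp add: conj_set_mult)
    moreover have "centralizes G c1 D" "centralizes G c2 D"
      using c1 c2 D_le by (auto simp: centralizes_def)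
    then have "centralizes G (c2 \<otimes> (c \<otimes> c1)) D"
      using centralizes_mult[OF c_carr c1(1) D_sub c(2)] centralizes_mult[OF c2(1) _ D_sub] c_carr c1(1)
      by blast
    ultimately show ?thesis
      using c1 c2 c_carr unfolding D_def by blast
  qed
qed

text \<open>Both \<open>P\<close> and \<open>Q = g\<^sup>-\<^sup>1 P g\<close> contain \<open>x\<close>, so some \<open>c\<close> that commutes with \<open>x\<close> carries \<open>P\<close> to \<open>Q\<close>.
  Then \<open>n = g c\<close> normalizes \<open>P\<close> and acts on \<open>x\<close> as \<open>g\<close> does. By the factorization of \<open>N(P)\<close>, the element \<open>n\<close> acts
  on \<open>P\<close> as an element of \<open>P\<close>.\<close>

lemma sylow_controls_fusion:
  fixes p :: nat
  assumes fin: "finite (carrier G)" and p: "prime p"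
    and coprime_central: "\<And>D q j h. \<lbrakk>subgroup D G; D \<noteq> {\<one>}; \<exists>i. card D = p ^ i; prime q; q \<noteq> p;
      h \<in> normalizer G D; h [^] (q ^ j :: nat) = \<one>\<rbrakk> \<Longrightarrow> centralizes G h D"
    and P: "sylow_subgroup G p P" and x: "x \<in> P" and g: "g \<in> carrier G" and gx: "g \<otimes> x \<otimes> inv g \<in> P"
  shows "\<exists>u\<in>P. g \<otimes> x \<otimes> inv g = u \<otimes> x \<otimes> inv u"
proof (cases "P = {\<one>}")
  case True
  then show ?thesis
    using x g by auto
next
  case False
  have P': "subgroup P G" "card P = p ^ multiplicity p (order G)"
    using P by (auto simp: sylow_subgroup_def)
  have P_sub: "P \<subseteq> carrier G"
    using P' subgroup.subset by blast
  have x_carr: "x \<in> carrier G"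
    using x P_sub by blast
  define Q where "Q = conj_set G (inv g) P"
  have Q: "sylow_subgroup G p Q"
    unfolding Q_def using P g sylow_conj_set by blast
  have "x \<in> Q"
    unfolding Q_def using mem_conj_set_iff[OF P_sub, of "inv g" x] g gx x_carr by simp
  obtain c where c: "c \<in> carrier G" "centralizes G c (P \<inter> Q)" "Q = conj_set G c P"
    using sylow_conj_by_centralizer_of_inter[OF fin p _ P Q] coprime_central by metis
  have c_x: "c \<otimes> x \<otimes> inv c = x"
    using centralizes_conj[OF c(1) x_carr] c(2) x \<open>x \<in> Q\<close> by (simp add: centralizes_def)
  define n where "n = g \<otimes> c"
  have n_carr: "n \<in> carrier G"
    using g c by (simp add: n_def)
  have n_x: "n \<otimes> x \<otimes> inv n = g \<otimes> x \<otimes> inv g"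
    using conj_mult[of g c x] c_x g c x_carr by (simp add: n_def)
  have "conj_set G n P = conj_set G g Q"
    using c g P_sub by (simp add: n_def conj_set_mult)
  also have "\<dots> = P"
    unfolding Q_def using conj_set_inv[OF P_sub, of "inv g"] g by simp
  finally have n_N: "n \<in> normalizer G P"
    using mem_normalizer_iff[OF P_sub] n_carr by simp
  let ?N = "normalizer G P"
  have N: "subgroup ?N G"
    using normalizer_imp_subgroup[OF P_sub] .
  have P_N: "P \<subseteq> ?N"
    using subgroup_le_normalizer[OF P'(1)] .
  have "sylow_subgroup (G\<lparr>carrier := ?N\<rparr>) p P"
    unfolding sylow_subgroup_def
  proof
    show "subgroup P (G\<lparr>carrier := ?N\<rparr>)"
      using subgroup_incl[OF P'(1) N P_N] .
    have cardN: "card ?N dvd order G" "card ?N \<noteq> 0"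
      using card_subgroup_dvd[OF fin N subgroup_self subgroup.subset[OF N]]
        subgroup.finite_imp_card_positive[OF N fin] by (auto simp: order_def)
    have "order G \<noteq> 0"
      using fin by (simp add: order_gt_0_iff_finite[symmetric])
    then have "multiplicity p (card ?N) \<le> multiplicity p (order G)"
      using cardN by (intro dvd_imp_multiplicity_le) auto
    moreover have "p ^ multiplicity p (order G) dvd card ?N"
      using card_subgroup_dvd[OF fin P'(1) N P_N] P'(2) by simp
    then have "multiplicity p (order G) \<le> multiplicity p (card ?N)"
      using cardN p by (intro multiplicity_geI) auto
    ultimately show "card P = p ^ multiplicity p (order (G\<lparr>carrier := ?N\<rparr>))"
      using P'(2) by (simp add: order_def)
  qed
  then obtain c' r where c': "c' \<in> ?N" "centralizes G c' P" and r: "r \<in> P" and n_eq: "n = c' \<otimes> r"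
    using normalizer_eq_centralizer_sylow[OF fin p P'(1) _ _ n_N] coprime_central P' False by blast
  have r_carr: "r \<in> carrier G" and c'_carr: "c' \<in> carrier G"
    using r P_sub c' subgroup.mem_carrier[OF N] by auto
  have rx: "r \<otimes> x \<otimes> inv r \<in> P"
    using r x P'(1) by (simp add: subgroup.m_closed subgroup.m_inv_closed)
  have "n \<otimes> x \<otimes> inv n = c' \<otimes> (r \<otimes> x \<otimes> inv r) \<otimes> inv c'"
    using conj_mult c'_carr r_carr x_carr n_eq by simp
  also have "\<dots> = r \<otimes> x \<otimes> inv r"
    using centralizes_conj[OF c'_carr] rx P_sub c'(2) by (auto simp: centralizes_def)
  finally show ?thesis
    using n_x r by auto
qed

end

section \<open>Simple groups with supersolvable proper subgroups\<close>

lemma (in group_hom) normal_preimage: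
  assumes M: "M \<lhd> H"
  shows "{x \<in> carrier G. h x \<in> M} \<lhd> G"
proof (rule G.normal_invI)
  interpret M: normal M H by (rule M)
  show "subgroup {x \<in> carrier G. h x \<in> M} G"
    by (rule G.subgroupI) (auto simp: M.m_closed M.m_inv_closed)
  fix x y assume "x \<in> carrier G" "y \<in> {x \<in> carrier G. h x \<in> M}"
  then show "x \<otimes> y \<otimes> inv x \<in> {x \<in> carrier G. h x \<in> M}"
    using M.inv_op_closed2[of "h x" "h y"] by simp
qed

lemma (in normal) coset_map_group_hom: "group_hom G (G Mod H) (\<lambda>x. H #> x)"
  using is_group factorgroup_is_group r_coset_hom_Mod
  by (simp add: group_hom_def group_hom_axioms_def)

lemma (in normal) coset_map_surj: "(\<lambda>x. H #> x) ` carrier G = carrier (G Mod H)"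
  by (simp add: carrier_FactGroup)

lemma (in normal) coset_map_eq_one_iff: "x \<in> carrier G \<Longrightarrow> H #> x = \<one>\<^bsub>G Mod H\<^esub> \<longleftrightarrow> x \<in> H"
  using coset_join1[OF _ _ subgroup_axioms] coset_join2[OF _ subgroup_axioms] by auto

context group
begin

lemma maximal_normal_subgroup_exists:
  assumes fin: "finite (carrier G)" and nontriv: "carrier G \<noteq> {\<one>}"
  obtains S where "S \<lhd> G" "S \<noteq> carrier G" "\<And>N. N \<lhd> G \<Longrightarrow> S \<subseteq> N \<Longrightarrow> N = S \<or> N = carrier G"
proof -
  let ?F = "{N. N \<lhd> G \<and> N \<noteq> carrier G}"
  have "?F \<subseteq> Pow (carrier G)"
    using normal_imp_subgroup subgroup.subset by blast
  then have "finite ?F"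
    using fin finite_subset by blast
  moreover have "{\<one>} \<in> ?F"
    using one_is_normal nontriv by auto
  ultimately obtain S where S: "S \<in> ?F" "\<forall>N\<in>?F. S \<subseteq> N \<longrightarrow> S = N"
    using finite_has_maximal[of ?F] by blast
  show thesis
  proof (rule that)
    show "S \<lhd> G" "S \<noteq> carrier G"
      using S(1) by auto
    fix N assume "N \<lhd> G" "S \<subseteq> N"
    then show "N = S \<or> N = carrier G"
      using S(2) by auto
  qed
qed

lemma quotient_by_maximal_normal_simple:
  assumes S: "S \<lhd> G" and max: "\<And>N. N \<lhd> G \<Longrightarrow> S \<subseteq> N \<Longrightarrow> N = S \<or> N = carrier G"
    and M: "M \<lhd> (G Mod S)"
  shows "M = carrier (G Mod S) \<or> M = {\<one>\<^bsub>G Mod S\<^esub>}"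
proof -
  interpret S: normal S G by (rule S)
  interpret \<pi>: group_hom G "G Mod S" "\<lambda>x. S #> x" by (rule S.coset_map_group_hom)
  have M_sub: "M \<subseteq> carrier (G Mod S)" and M_one: "\<one>\<^bsub>G Mod S\<^esub> \<in> M"
    using subgroup.subset[OF normal_imp_subgroup[OF M]] subgroup.one_closed[OF normal_imp_subgroup[OF M]]
    by auto
  let ?N = "{x \<in> carrier G. S #> x \<in> M}"
  have "M \<subseteq> (\<lambda>x. S #> x) ` carrier G"
    using M_sub unfolding S.coset_map_surj .
  then have M_img: "M = (\<lambda>x. S #> x) ` ?N"
    by blast
  have "S \<subseteq> ?N"
  proof
    fix x assume x: "x \<in> S"
    then have "S #> x = \<one>\<^bsub>G Mod S\<^esub>"
      using S.coset_map_eq_one_iff[of x] by simp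
    then show "x \<in> ?N"
      using x M_one by simp
  qed
  then have "?N = S \<or> ?N = carrier G"
    using max[OF \<pi>.normal_preimage[OF M]] by simp
  then show ?thesis
  proof
    assume 1: "?N = S"
    have "(\<lambda>x. S #> x) ` S \<subseteq> {\<one>\<^bsub>G Mod S\<^esub>}"
      using S.coset_map_eq_one_iff by (intro image_subsetI) simp
    then show ?thesis
      using M_img[unfolded 1] M_one by blast
  next
    assume "?N = carrier G"
    then show ?thesis
      using M_img S.coset_map_surj by simp
  qed
qed

lemma p_group_coprime_power_eq_one:
  assumes "x \<in> carrier G" "order G = p ^ k" "prime p" "\<not> p dvd n" "x [^] (n::nat) = \<one>"
  shows "x = \<one>"
proof -
  have "ord x dvd p ^ k"
    using assms ord_dvd_group_order by metis
  moreover have "ord x dvd n"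
    using assms pow_eq_id by blast
  moreover have "coprime (p ^ k) n"
    using assms by (simp add: prime_imp_coprime)
  ultimately have "ord x = 1"
    by (metis coprime_common_divisor_nat)
  then show ?thesis
    using ord_eq_1 assms by blast
qed

text \<open>Unless \<open>G\<close> is a \<open>p\<close>-group, take the smallest prime divisor \<open>p\<close> of its order. The normalizers of the
  nontrivial \<open>p\<close>-subgroups \<open>D\<close> are proper by simplicity, hence supersolvable, so that their elements of
  \<open>q\<close>-power order with \<open>q \<noteq> p\<close> centralize \<open>D\<close>. Therefore a Sylow \<open>p\<close>-subgroup \<open>P\<close> controls fusion, and any
  homomorphism from \<open>P\<close> to an abelian group is invariant under conjugation in \<open>G\<close>. For a nontrivial one
  the transfer is nontrivial on \<open>P\<close>, since the index of \<open>P\<close> is prime to \<open>p\<close>. By simplicity the transfer embeds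
  \<open>G\<close> into an abelian group.\<close>

theorem simple_group_with_supersolvable_subgroups_comm:
  assumes fin: "finite (carrier G)"
    and simple: "\<And>N. N \<lhd> G \<Longrightarrow> N = carrier G \<or> N = {\<one>}"
    and ss: "\<And>T. subgroup T G \<Longrightarrow> T \<noteq> carrier G \<Longrightarrow> supersolvable (G\<lparr>carrier := T\<rparr>)"
  shows "comm_group G"
proof (cases "\<exists>p k. prime (p::nat) \<and> order G = p ^ k")
  case True
  then show ?thesis
    using simple_p_group_comm simple by blast
next
  case not_p_group: False
  have ord_pos: "order G \<noteq> 0"
    using fin by (simp add: order_gt_0_iff_finite[symmetric])
  have "order G \<noteq> 1"
    using not_p_group two_is_prime_nat by (metis power_0)
  then have "\<exists>p. prime p \<and> p dvd order G"
    using prime_factor_nat by blast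
  then obtain p where p: "prime p" "p dvd order G" and p_least: "\<And>q. prime q \<Longrightarrow> q dvd order G \<Longrightarrow> p \<le> q"
    using LeastI_ex[of "\<lambda>p. prime p \<and> p dvd order G"] Least_le[of "\<lambda>p. prime p \<and> p dvd order G"]
    by blast
  have coprime_central: "centralizes G h D"
    if D: "subgroup D G" "D \<noteq> {\<one>}" "\<exists>i. card D = p ^ i" and q: "prime q" "q \<noteq> p"
      and h: "h \<in> normalizer G D" "h [^] (q ^ j :: nat) = \<one>" for D q j h
  proof -
    let ?N = "normalizer G D"
    have D_sub: "D \<subseteq> carrier G"
      using subgroup.subset[OF D(1)] .
    have N: "subgroup ?N G"
      using normalizer_imp_subgroup[OF D_sub] .
    have D_N: "D \<lhd> (G\<lparr>carrier := ?N\<rparr>)"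
      using subgroup_in_normalizer[OF D(1)] .
    have h_carr: "h \<in> carrier G"
      using subgroup.mem_carrier[OF N h(1)] .
    obtain i where i: "card D = p ^ i"
      using D(3) by blast
    have "?N \<noteq> carrier G"
    proof
      assume "?N = carrier G"
      then have "D \<lhd> G"
        using D_N by simp
      then have "D = carrier G"
        using simple D(2) by blast
      then show False
        using not_p_group p(1) i by (auto simp: order_def)
    qed
    then have seq: "supersolvable_seq (G\<lparr>carrier := ?N\<rparr>) ?N"
      using ss[OF N] by (simp add: supersolvable_def)
    interpret N: group "G\<lparr>carrier := ?N\<rparr>"
      using N subgroup_imp_group by blast
    interpret D: group "G\<lparr>carrier := D\<rparr>"
      using D(1) subgroup_imp_group by blast
    show ?thesis
    proof (cases "h = \<one>")
      case True
      then show ?thesis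
        using D_sub by (auto simp: centralizes_def)
    next
      case False
      have "ord h dvd q ^ j"
        using h h_carr pow_eq_id by blast
      then obtain l where l: "ord h = q ^ l"
        using divides_primepow_nat[OF q(1)] by blast
      have "l \<noteq> 0"
        using False l ord_eq_1[OF h_carr] by (metis power_0)
      then have "q dvd ord h"
        using l by simp
      then have "q dvd order G"
        using ord_dvd_group_order[OF h_carr] dvd_trans by blast
      then have "p < q"
        using p_least[OF q(1)] q(2) by simp
      have "h \<otimes> d = d \<otimes> h" if d: "d \<in> D" for d
      proof -
        have D_pow: "e [^]\<^bsub>G\<lparr>carrier := ?N\<rparr>\<^esub> (p ^ i) = \<one>\<^bsub>G\<lparr>carrier := ?N\<rparr>\<^esub>" if "e \<in> D" for e
          using D.pow_order_eq_1[of e] that i by (simp add: order_def nat_pow_consistent[symmetric])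
        have "h [^]\<^bsub>G\<lparr>carrier := ?N\<rparr>\<^esub> (q ^ j) = \<one>\<^bsub>G\<lparr>carrier := ?N\<rparr>\<^esub>"
          using h(2) by (simp add: nat_pow_consistent[symmetric])
        then show ?thesis
          using N.supersolvable_seq_centralizes[OF seq D_N D_pow, of h q j d] h(1) p(1) q(1) \<open>p < q\<close> d
            subgroup_le_normalizer[OF D(1)] by auto
      qed
      then show ?thesis
        by (simp add: centralizes_def)
    qed
  qed
  obtain P where P: "sylow_subgroup G p P"
    using sylow_subgroup_exists[OF fin p(1)] by auto
  define m where "m = multiplicity p (order G)"
  have P_sub: "subgroup P G" and card_P: "card P = p ^ m"
    using P by (auto simp: sylow_subgroup_def m_def)
  have "1 \<le> m"
    unfolding m_def using p ord_pos by (intro multiplicity_geI) auto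
  then have "card P \<noteq> 1"
    using card_P p(1) by (simp add: prime_nat_iff)
  interpret P: group "G\<lparr>carrier := P\<rparr>"
    using P_sub subgroup_imp_group by blast
  have finP: "finite P"
    using finite_subset[OF subgroup.subset[OF P_sub] fin] .
  \<comment> \<open>The factor \<open>P / S\<close> is a simple \<open>p\<close>-group, hence abelian; it serves as the target of the transfer.\<close>
  obtain S where S: "S \<lhd> (G\<lparr>carrier := P\<rparr>)" "S \<noteq> P"
    and S_max: "\<And>N. N \<lhd> (G\<lparr>carrier := P\<rparr>) \<Longrightarrow> S \<subseteq> N \<Longrightarrow> N = S \<or> N = P"
  proof (rule P.maximal_normal_subgroup_exists)
    show "finite (carrier (G\<lparr>carrier := P\<rparr>))" "carrier (G\<lparr>carrier := P\<rparr>) \<noteq> {\<one>\<^bsub>G\<lparr>carrier := P\<rparr>\<^esub>}"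
      using finP \<open>card P \<noteq> 1\<close> by auto
  qed (use that in simp)
  interpret S: normal S "G\<lparr>carrier := P\<rparr>" by (rule S(1))
  define A where "A = (G\<lparr>carrier := P\<rparr>) Mod S"
  interpret \<pi>: group_hom "G\<lparr>carrier := P\<rparr>" A "\<lambda>x. S #> x"
    using S.coset_map_group_hom by (simp add: A_def)
  have "order A = card (rcosets\<^bsub>G\<lparr>carrier := P\<rparr>\<^esub> S)"
    by (simp add: A_def order_def FactGroup_def)
  moreover have "card (rcosets\<^bsub>G\<lparr>carrier := P\<rparr>\<^esub> S) * card S = p ^ m"
    using P.lagrange[OF S.subgroup_axioms] card_P by (simp add: order_def)
  ultimately have "order A dvd p ^ m"
    by (metis dvd_triv_left)
  then obtain k where order_A: "order A = p ^ k"
    using divides_primepow_nat[OF p(1)] by blast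
  have "comm_group A"
  proof (rule \<pi>.H.simple_p_group_comm[OF order_A p(1)])
    show "N = carrier A \<or> N = {\<one>\<^bsub>A\<^esub>}" if "N \<lhd> A" for N
      using P.quotient_by_maximal_normal_simple[OF S(1)] S_max that by (simp add: A_def)
  qed
  then interpret A: comm_group A .
  have hom: "(\<lambda>x. S #> x) \<in> hom (G\<lparr>carrier := P\<rparr>) A"
    by (rule \<pi>.homh)
  interpret conjugation_invariant_hom G A P "\<lambda>x. S #> x"
  proof (intro conjugation_invariant_hom.intro conjugation_invariant_hom_axioms.intro)
    fix x g assume x: "x \<in> P" and g: "g \<in> carrier G" "g \<otimes> x \<otimes> inv g \<in> P"
    obtain u where u: "u \<in> P" "g \<otimes> x \<otimes> inv g = u \<otimes> x \<otimes> inv u"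
      using sylow_controls_fusion[OF fin p(1) _ P x g] coprime_central by metis
    have "inv u \<in> P"
      using subgroup.m_inv_closed[OF P_sub u(1)] .
    then have "S #> (u \<otimes> x \<otimes> inv u) = (S #> u) \<otimes>\<^bsub>A\<^esub> (S #> x) \<otimes>\<^bsub>A\<^esub> (S #> inv u)"
      using \<pi>.hom_mult[of u x] \<pi>.hom_mult[of "u \<otimes> x" "inv u"] u x subgroup.m_closed[OF P_sub] by simp
    also have "\<dots> = (S #> u) \<otimes>\<^bsub>A\<^esub> (S #> inv u) \<otimes>\<^bsub>A\<^esub> (S #> x)"
      using \<pi>.hom_closed[of u] \<pi>.hom_closed[of x] \<pi>.hom_closed[of "inv u"] u x \<open>inv u \<in> P\<close>
      by (simp add: A.m_ac)
    also have "(S #> u) \<otimes>\<^bsub>A\<^esub> (S #> inv u) = \<one>\<^bsub>A\<^esub>"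
      using \<pi>.hom_mult[of u "inv u"] u \<open>inv u \<in> P\<close> subgroup.mem_carrier[OF P_sub u(1)] \<pi>.hom_one by simp
    finally show "S #> (g \<otimes> x \<otimes> inv g) = S #> x"
      using u(2) \<pi>.hom_closed[of x] x by simp
  qed (fact is_group A.comm_group_axioms fin P_sub hom)+
  obtain V where V: "V \<in> hom G A" "\<And>u. u \<in> P \<Longrightarrow> V u = (S #> u) [^]\<^bsub>A\<^esub> card (rcosets P)"
    by (rule transfer_hom_exists) (rule that)
  interpret V: group_hom G A V
    using V(1) by unfold_locales
  have "kernel G A V \<noteq> carrier G"
  proof
    assume ker: "kernel G A V = carrier G"
    obtain u where u: "u \<in> P" "u \<notin> S"
      using S(2) S.subset by auto
    have "u \<in> kernel G A V"
      unfolding ker using subgroup.mem_carrier[OF P_sub u(1)] .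
    then have "(S #> u) [^]\<^bsub>A\<^esub> card (rcosets P) = \<one>\<^bsub>A\<^esub>"
      unfolding V(2)[OF u(1), symmetric] by (simp add: kernel_def)
    moreover have "S #> u \<in> carrier A"
      using \<pi>.hom_closed[of u] u(1) by simp
    ultimately have "S #> u = \<one>\<^bsub>A\<^esub>"
      using \<pi>.H.p_group_coprime_power_eq_one[OF _ order_A p(1)] sylow_index_not_dvd[OF fin p(1) P]
      by metis
    then show False
      using S.coset_map_eq_one_iff[of u] u by (simp add: A_def)
  qed
  then have "kernel G A V = {\<one>}"
    using simple V.normal_kernel by blast
  then have inj: "inj_on V (carrier G)"
    by (rule V.trivial_ker_imp_inj)
  show ?thesis
  proof (rule group_comm_groupI)
    fix x y assume xy: "x \<in> carrier G" "y \<in> carrier G"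
    then have "V (x \<otimes> y) = V (y \<otimes> x)"
      by (simp add: A.m_comm)
    then show "x \<otimes> y = y \<otimes> x"
      using inj_onD[OF inj] xy by blast
  qed
qed

end

section \<open>Supersolvability of a quotient in terms of the group\<close>

text \<open>For normal \<open>N\<close>, the group \<open>G / N\<close> is supersolvable iff such a series leads from \<open>N\<close> to \<open>carrier G\<close>. The
  terms are subgroups of \<open>G\<close> rather than of the quotient, so that series for different \<open>N\<close> can be
  intersected with subgroups and joined. The last premise says that the factor is generated by the coset of \<open>a\<close>.\<close>

inductive normal_cyclic_series :: "('a, 'b) monoid_scheme \<Rightarrow> 'a set \<Rightarrow> 'a set \<Rightarrow> bool"
  for G N where
    base: "normal_cyclic_series G N N"
  | step: "\<lbrakk>normal_cyclic_series G N K; K \<subseteq> H; H \<lhd> G; a \<in> H;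
            \<And>x. x \<in> H \<Longrightarrow> \<exists>n::int. x \<otimes>\<^bsub>G\<^esub> inv\<^bsub>G\<^esub> (a [^]\<^bsub>G\<^esub> n) \<in> K\<rbrakk> \<Longrightarrow> normal_cyclic_series G N H"

lemma normal_cyclic_series_trans:
  assumes "normal_cyclic_series G M K" "normal_cyclic_series G N M"
  shows "normal_cyclic_series G N K"
  using assms by (induction rule: normal_cyclic_series.induct) (auto intro: normal_cyclic_series.step)

lemma normal_cyclic_series_normal:
  assumes "normal_cyclic_series G N K" "N \<lhd> G"
  shows "K \<lhd> G"
  using assms by (cases rule: normal_cyclic_series.cases) auto

lemma int_subgroup_principal:
  fixes I :: "int set"
  assumes I: "0 \<in> I" "\<And>m n. m \<in> I \<Longrightarrow> n \<in> I \<Longrightarrow> m - n \<in> I"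
  obtains d where "d \<in> I" "\<And>n. n \<in> I \<Longrightarrow> d dvd n"
proof (cases "I = {0}")
  case True
  then show ?thesis
    using that by auto
next
  case False
  have neg: "- n \<in> I" if "n \<in> I" for n
    using I(2)[OF I(1) that] by simp
  have add: "m + n \<in> I" if "m \<in> I" "n \<in> I" for m n
    using I(2)[OF that(1) neg[OF that(2)]] by simp
  have mult_nat: "int k * n \<in> I" if "n \<in> I" for k n
    using I(1) add[OF that] by (induction k) (auto simp: distrib_right)
  have mult: "k * n \<in> I" if "n \<in> I" for k n
    using mult_nat[OF that, of "nat k"] neg[OF mult_nat[OF that, of "nat (- k)"]]
    by (cases "k \<ge> 0") auto
  obtain m where m: "m \<in> I" "m \<noteq> 0"
    using False I(1) by blast
  have "\<exists>k. k > 0 \<and> int k \<in> I"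
    using m neg[OF m(1)] by (intro exI[of _ "nat \<bar>m\<bar>"]) (auto simp: abs_if)
  then obtain d where d: "d > 0" "int d \<in> I" and least: "\<And>k. k > 0 \<Longrightarrow> int k \<in> I \<Longrightarrow> d \<le> k"
    using LeastI_ex[of "\<lambda>k. k > 0 \<and> int k \<in> I"] Least_le[of "\<lambda>k. k > 0 \<and> int k \<in> I"] by blast
  have "int d dvd n" if n: "n \<in> I" for n
  proof (rule ccontr)
    assume "\<not> int d dvd n"
    then have pos: "n mod int d > 0"
      using d(1) by (metis dvd_eq_mod_eq_0 less_le of_nat_0_less_iff pos_mod_sign)
    have "n mod int d = n - (n div int d) * int d"
      by (simp add: minus_div_mult_eq_mod)
    then have "n mod int d \<in> I"
      using I(2)[OF n mult[OF d(2)]] by simp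
    then have "d \<le> nat (n mod int d)"
      using pos by (intro least) auto
    then show False
      using pos_mod_bound[of "int d" n] d(1) pos by linarith
  qed
  then show ?thesis
    using that d(2) by blast
qed

context group
begin

lemma coset_eq_iff:
  assumes "subgroup K G" "x \<in> carrier G" "y \<in> carrier G"
  shows "K #> x = K #> y \<longleftrightarrow> x \<otimes> inv y \<in> K"
proof -
  have "K #> x = K #> y \<longleftrightarrow> x \<in> K #> y"
    using assms rcos_self[of x K] repr_independence[of x K y] by auto
  then show ?thesis
    using subgroup.rcos_module[OF assms(1) is_group assms(3) assms(2)] by simp
qed

lemma cyclic_factor_iff_mem:
  assumes K: "K \<lhd> (G\<lparr>carrier := H\<rparr>)" and H: "subgroup H G"
  shows "cyclic_group ((G\<lparr>carrier := H\<rparr>) Mod K) \<longleftrightarrow>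
    (\<exists>a\<in>H. \<forall>x\<in>H. \<exists>n::int. x \<otimes> inv (a [^] n) \<in> K)"
proof -
  have K_sub: "subgroup K G"
    using incl_subgroup[OF H normal_imp_subgroup[OF K]] .
  have "K #> x = K #> (a [^] n) \<longleftrightarrow> x \<otimes> inv (a [^] n) \<in> K" if "x \<in> H" "a \<in> H" for x a and n :: int
    using coset_eq_iff[OF K_sub] subgroup.mem_carrier[OF H] that by simp
  then show ?thesis
    unfolding cyclic_factor_iff[OF K H] by simp
qed

text \<open>A factor of the new series embeds into the factor \<open>H / K\<close> of the old one. The exponents \<open>n\<close> for which the coset
  \<open>K a\<^sup>n\<close> meets \<open>H \<inter> M\<close> form a subgroup of the integers, generated by some \<open>d\<close>; an element of \<open>H \<inter> M\<close> in
  \<open>K a\<^sup>d\<close> generates the new factor.\<close>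

lemma normal_cyclic_series_inter:
  assumes N: "N \<lhd> G" and M: "M \<lhd> G" and series: "normal_cyclic_series G N K"
  shows "normal_cyclic_series G (N \<inter> M) (K \<inter> M)"
  using series
proof (induction rule: normal_cyclic_series.induct)
  case base
  show ?case
    by (rule normal_cyclic_series.base)
next
  case (step K H a)
  have K: "K \<lhd> G"
    using normal_cyclic_series_normal[OF step.hyps(1) N] .
  interpret K: normal K G by (rule K)
  interpret \<pi>: group_hom G "G Mod K" "\<lambda>x. K #> x" by (rule K.coset_map_group_hom)
  have HM: "H \<inter> M \<lhd> G"
    using normal_subgroup_intersect step.hyps(3) M by blast
  have HM_sub: "subgroup (H \<inter> M) G"
    using HM by (rule normal_imp_subgroup)
  have HM_carr: "x \<in> carrier G" if "x \<in> H \<inter> M" for x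
    using subgroup.mem_carrier[OF HM_sub that] .
  have a: "a \<in> carrier G"
    using subgroup.mem_carrier[OF normal_imp_subgroup[OF step.hyps(3)] step.hyps(4)] .
  have pow: "K #> (x [^] n) = (K #> x) [^]\<^bsub>G Mod K\<^esub> n" if "x \<in> carrier G" for x and n :: int
    using \<pi>.hom_int_pow[OF that] .
  define I where "I = {n::int. \<exists>x\<in>H \<inter> M. K #> x = K #> (a [^] n)}"
  have "0 \<in> I"
    unfolding I_def using subgroup.one_closed[OF HM_sub] by force
  moreover have "m - n \<in> I" if mn: "m \<in> I" "n \<in> I" for m n
  proof -
    obtain x y where x: "x \<in> H \<inter> M" "K #> x = K #> (a [^] m)" and y: "y \<in> H \<inter> M" "K #> y = K #> (a [^] n)"
      using mn by (auto simp: I_def)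
    have "K #> (x \<otimes> inv y) = K #> (a [^] m \<otimes> inv (a [^] n))"
      using x y HM_carr a \<pi>.hom_mult \<pi>.hom_inv by (simp del: mult_FactGroup)
    moreover have "x \<otimes> inv y \<in> H \<inter> M"
      using subgroup.m_closed[OF HM_sub x(1) subgroup.m_inv_closed[OF HM_sub y(1)]] .
    ultimately show ?thesis
      unfolding I_def using int_pow_diff[OF a, of m n] by auto
  qed
  ultimately obtain d where d: "d \<in> I" "\<And>n. n \<in> I \<Longrightarrow> d dvd n"
    using int_subgroup_principal by blast
  obtain b where b: "b \<in> H \<inter> M" "K #> b = K #> (a [^] d)"
    using d(1) by (auto simp: I_def)
  show ?case
  proof (rule normal_cyclic_series.step[OF step.IH _ HM b(1)])
    show "K \<inter> M \<subseteq> H \<inter> M"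
      using step.hyps(2) by blast
    fix x assume x: "x \<in> H \<inter> M"
    obtain n :: int where n: "x \<otimes> inv (a [^] n) \<in> K"
      using step.hyps(5) x by blast
    then have x_n: "K #> x = K #> (a [^] n)"
      using coset_eq_iff[OF K.subgroup_axioms HM_carr[OF x]] a by simp
    then have "n \<in> I"
      unfolding I_def using x by blast
    then obtain k where k: "n = d * k"
      using d(2) by blast
    have "K #> (b [^] k) = (K #> (a [^] d)) [^]\<^bsub>G Mod K\<^esub> k"
      using pow[OF HM_carr[OF b(1)]] b(2) by simp
    also have "\<dots> = K #> (a [^] n)"
      using pow[of "a [^] d" k] a k by (simp add: int_pow_pow)
    finally have "K #> x = K #> (b [^] k)"
      using x_n by simp
    then have "x \<otimes> inv (b [^] k) \<in> K"
      using coset_eq_iff[OF K.subgroup_axioms HM_carr[OF x] int_pow_closed[OF HM_carr[OF b(1)]]] by blast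
    moreover have "x \<otimes> inv (b [^] k) \<in> M"
      using subgroup_int_pow_closed[OF HM_sub b(1), of k] x normal_imp_subgroup[OF M]
      by (auto intro: subgroup.m_closed subgroup.m_inv_closed)
    ultimately show "\<exists>n::int. x \<otimes> inv (b [^] n) \<in> K \<inter> M"
      by blast
  qed
qed

end

context group_hom
begin

lemma supersolvable_seq_preimage:
  assumes surj: "h ` carrier G = carrier H" and seq: "supersolvable_seq H K"
  shows "normal_cyclic_series G (kernel G H h) {x \<in> carrier G. h x \<in> K}"
  using seq
proof (induction rule: supersolvable_seq.induct)
  case unity
  show ?case
    using normal_cyclic_series.base[of G "kernel G H h"] by (simp add: kernel_def)
next
  case (extension K L)
  have L: "subgroup L H"
    using normal_imp_subgroup[OF extension.hyps(3)] .
  obtain b where b: "b \<in> L" "\<And>y. y \<in> L \<Longrightarrow> \<exists>n::int. y \<otimes>\<^bsub>H\<^esub> inv\<^bsub>H\<^esub> (b [^]\<^bsub>H\<^esub> n) \<in> K"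
    using extension.hyps(4) unfolding H.cyclic_factor_iff_mem[OF extension.hyps(2) L] by blast
  have "b \<in> h ` carrier G"
    unfolding surj using subgroup.mem_carrier[OF L b(1)] .
  then obtain a where a: "a \<in> carrier G" "b = h a"
    by blast
  show ?case
  proof (rule normal_cyclic_series.step[OF extension.IH])
    show "{x \<in> carrier G. h x \<in> K} \<subseteq> {x \<in> carrier G. h x \<in> L}"
      using subgroup.subset[OF normal_imp_subgroup[OF extension.hyps(2)]] by auto
    show "{x \<in> carrier G. h x \<in> L} \<lhd> G"
      using normal_preimage[OF extension.hyps(3)] .
    show "a \<in> {x \<in> carrier G. h x \<in> L}"
      using a b(1) by simp
    fix x assume x: "x \<in> {x \<in> carrier G. h x \<in> L}"
    then obtain n :: int where n: "h x \<otimes>\<^bsub>H\<^esub> inv\<^bsub>H\<^esub> (b [^]\<^bsub>H\<^esub> n) \<in> K"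
      using b(2) by blast
    have "h (x \<otimes> inv (a [^] n)) = h x \<otimes>\<^bsub>H\<^esub> inv\<^bsub>H\<^esub> (b [^]\<^bsub>H\<^esub> n)"
      using x a by (simp add: hom_int_pow)
    then show "\<exists>n::int. x \<otimes> inv (a [^] n) \<in> {x \<in> carrier G. h x \<in> K}"
      using n x a(1) by (intro exI[of _ n]) simp
  qed
qed

text \<open>With \<open>N\<close> smaller than the kernel this includes that quotients of the supersolvable group \<open>G / N\<close> are
  supersolvable.\<close>

lemma normal_cyclic_series_image:
  assumes surj: "h ` carrier G = carrier H" and N: "N \<lhd> G" "N \<subseteq> kernel G H h"
    and series: "normal_cyclic_series G N K"
  shows "supersolvable_seq H (h ` K)"
  using series
proof (induction rule: normal_cyclic_series.induct)
  case base
  have "h ` N = {\<one>\<^bsub>H\<^esub>}"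
    using N(2) subgroup.one_closed[OF normal_imp_subgroup[OF N(1)]] hom_one by (force simp: kernel_def)
  then show ?case
    by (simp add: supersolvable_seq.unity)
next
  case (step K L a)
  have K: "K \<lhd> G"
    using normal_cyclic_series_normal[OF step.hyps(1) N(1)] .
  have hK: "h ` K \<lhd> H" and hL: "h ` L \<lhd> H"
    using normal.surj_hom_normal_subgroup[OF _ group_hom_axioms surj] K step.hyps(3) by auto
  have L_sub: "subgroup L G" and hL_sub: "subgroup (h ` L) H"
    using normal_imp_subgroup step.hyps(3) hL by auto
  have hK_L: "h ` K \<lhd> (H\<lparr>carrier := h ` L\<rparr>)"
    using H.normal_restrict_supergroup[OF hL_sub hK] step.hyps(2) by blast
  have "\<exists>n::int. y \<otimes>\<^bsub>H\<^esub> inv\<^bsub>H\<^esub> (h a [^]\<^bsub>H\<^esub> n) \<in> h ` K" if y: "y \<in> h ` L" for y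
  proof -
    obtain x where x: "x \<in> L" "y = h x"
      using y by blast
    obtain n :: int where n: "x \<otimes> inv (a [^] n) \<in> K"
      using step.hyps(5)[OF x(1)] by blast
    have "h (x \<otimes> inv (a [^] n)) = y \<otimes>\<^bsub>H\<^esub> inv\<^bsub>H\<^esub> (h a [^]\<^bsub>H\<^esub> n)"
      using x subgroup.mem_carrier[OF L_sub] step.hyps(4) by (simp add: hom_int_pow)
    then show ?thesis
      using n by (metis imageI)
  qed
  then have "cyclic_group ((H\<lparr>carrier := h ` L\<rparr>) Mod (h ` K))"
    unfolding H.cyclic_factor_iff_mem[OF hK_L hL_sub] using step.hyps(4) by blast
  then show ?case
    using supersolvable_seq.extension[OF step.IH hK_L hL] by blast
qed

end

section \<open>The supersolvable residual and the norm\<close>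

context group
begin

lemma trivial_quotient_supersolvable: "supersolvable (G Mod carrier G)"
proof -
  have "carrier (G Mod carrier G) = {\<one>\<^bsub>G Mod carrier G\<^esub>}"
    using coset_join2[OF _ subgroup_self] one_closed by (fastforce simp: carrier_FactGroup)
  then show ?thesis
    using normal.factorgroup_is_group[OF normal_self] supersolvable_seq.unity[of "G Mod carrier G"]
    by (simp add: supersolvable_def)
qed

lemma supersolvable_quotient_series:
  assumes N: "N \<lhd> G" and ss: "supersolvable (G Mod N)"
  shows "normal_cyclic_series G N (carrier G)"
proof -
  interpret N: normal N G by (rule N)
  interpret \<pi>: group_hom G "G Mod N" "\<lambda>x. N #> x" by (rule N.coset_map_group_hom)
  have "kernel G (G Mod N) (\<lambda>x. N #> x) = N"
    using N.coset_map_eq_one_iff N.subset by (auto simp: kernel_def simp del: one_FactGroup)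
  moreover have "{x \<in> carrier G. N #> x \<in> carrier (G Mod N)} = carrier G"
    by auto
  ultimately show ?thesis
    using \<pi>.supersolvable_seq_preimage[OF N.coset_map_surj, of "carrier (G Mod N)"] ss
    by (simp add: supersolvable_def)
qed

text \<open>The quotient of \<open>G\<close> by its residual is supersolvable. For two normal subgroups \<open>N\<close> and \<open>M\<close> with
  supersolvable quotients, intersecting a series that runs from \<open>N\<close> to \<open>G\<close> with \<open>M\<close> gives a series from \<open>N \<inter> M\<close> to
  \<open>M\<close>, which continues up to \<open>G\<close>. The residual is an intersection of finitely many such subgroups.\<close>

lemma supersolvable_residual_series:
  assumes fin: "finite (carrier G)"
  shows "supersolvable_residual G \<lhd> G \<and>
    normal_cyclic_series G (supersolvable_residual G) (carrier G)"
proof -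
  let ?F = "{N. N \<lhd> G \<and> supersolvable (G Mod N)}"
  have sub: "N \<subseteq> carrier G" if "N \<lhd> G" for N
    using subgroup.subset[OF normal_imp_subgroup[OF that]] .
  have "?F \<subseteq> Pow (carrier G)"
    using sub by blast
  then have "finite ?F"
    using fin finite_subset by blast
  moreover have "?F \<noteq> {}"
    using normal_self trivial_quotient_supersolvable by blast
  moreover have "\<Inter>F \<lhd> G \<and> normal_cyclic_series G (\<Inter>F) (carrier G)"
    if "finite F" "F \<noteq> {}" "F \<subseteq> ?F" for F
    using that
  proof (induction rule: finite_ne_induct)
    case (singleton N)
    then show ?case
      using supersolvable_quotient_series by simp
  next
    case (insert N F)
    then have N: "N \<lhd> G" "normal_cyclic_series G N (carrier G)"
      and F: "\<Inter>F \<lhd> G" "normal_cyclic_series G (\<Inter>F) (carrier G)"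
      using supersolvable_quotient_series by auto
    have "normal_cyclic_series G (N \<inter> \<Inter>F) (carrier G \<inter> \<Inter>F)"
      using normal_cyclic_series_inter[OF N(1) F(1) N(2)] .
    then have "normal_cyclic_series G (N \<inter> \<Inter>F) (\<Inter>F)"
      using sub[OF F(1)] by (simp add: Int_absorb1)
    then have "normal_cyclic_series G (N \<inter> \<Inter>F) (carrier G)"
      using normal_cyclic_series_trans[OF F(2)] by blast
    then show ?case
      using normal_subgroup_intersect[OF N(1) F(1)] by simp
  qed
  ultimately show ?thesis
    unfolding supersolvable_residual_def by blast
qed

lemma supersolvable_residual_subset: "supersolvable_residual G \<subseteq> carrier G"
  unfolding supersolvable_residual_def using normal_self trivial_quotient_supersolvable by blast

lemma subgroup_residual_subset:
  "subgroup T G \<Longrightarrow> supersolvable_residual (G\<lparr>carrier := T\<rparr>) \<subseteq> T"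
  using group.supersolvable_residual_subset[OF subgroup_imp_group] by fastforce

text \<open>If \<open>T / N\<close> is supersolvable, then so is its image \<open>g T g\<^sup>-\<^sup>1 / g N g\<^sup>-\<^sup>1\<close> under conjugation.
  Hence each \<open>N\<close> in the intersection that defines the residual of \<open>T\<close> has its conjugate in the one for \<open>g T g\<^sup>-\<^sup>1\<close>.\<close>

lemma residual_conj_subset:
  assumes T: "subgroup T G" and g: "g \<in> carrier G"
  shows "supersolvable_residual (G\<lparr>carrier := conj_set G g T\<rparr>) \<subseteq> conj_set G g (supersolvable_residual (G\<lparr>carrier := T\<rparr>))"
proof
  let ?T = "G\<lparr>carrier := T\<rparr>" and ?gT = "G\<lparr>carrier := conj_set G g T\<rparr>"
  fix y assume y: "y \<in> supersolvable_residual ?gT"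
  have T_sub: "T \<subseteq> carrier G"
    using subgroup.subset[OF T] .
  have gT: "subgroup (conj_set G g T) G"
    using conj_set_subgroup[OF T g] .
  interpret T: group ?T
    using subgroup_imp_group[OF T] .
  interpret gT: group ?gT
    using subgroup_imp_group[OF gT] .
  let ?c = "\<lambda>x. g \<otimes> x \<otimes> inv g"
  have c_hom: "group_hom ?T ?gT ?c"
    using T_sub g conj_hom T.is_group gT.is_group
    by (auto simp: group_hom_def group_hom_axioms_def hom_def conj_set_def subset_iff)
  have c_surj: "?c ` carrier ?T = carrier ?gT"
    by (simp add: conj_set_def)
  have y_carr: "y \<in> carrier G"
    using y subgroup_residual_subset[OF gT] subgroup.subset[OF gT] by blast
  have "inv g \<otimes> y \<otimes> g \<in> N" if N: "N \<lhd> ?T" "supersolvable (?T Mod N)" for N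
  proof -
    have N_sub: "N \<subseteq> carrier G"
      using subgroup.subset[OF normal_imp_subgroup[OF N(1)]] T_sub by simp
    have gN: "conj_set G g N \<lhd> ?gT"
      using normal.surj_hom_normal_subgroup[OF N(1) c_hom c_surj] by (simp add: conj_set_def)
    interpret gN: normal "conj_set G g N" ?gT by (rule gN)
    let ?Q = "?gT Mod conj_set G g N" and ?\<pi> = "\<lambda>x. conj_set G g N #>\<^bsub>?gT\<^esub> x"
    have comp_hom: "group_hom ?T ?Q (?\<pi> \<circ> ?c)"
      using Group.hom_compose[OF group_hom.homh[OF c_hom] gN.r_coset_hom_Mod]
        T.is_group gN.factorgroup_is_group
      by (simp only: group_hom_def group_hom_axioms_def)
    have "(?\<pi> \<circ> ?c) ` carrier ?T = carrier ?Q"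
      using gN.coset_map_surj c_surj by (metis image_comp)
    moreover have "N \<subseteq> kernel ?T ?Q (?\<pi> \<circ> ?c)"
    proof
      fix x assume x: "x \<in> N"
      have "?c x \<in> conj_set G g N"
        using x by (auto simp: conj_set_def)
      then have "?\<pi> (?c x) = \<one>\<^bsub>?Q\<^esub>"
        using gN.coset_map_eq_one_iff gN.subset by blast
      then show "x \<in> kernel ?T ?Q (?\<pi> \<circ> ?c)"
        using subgroup.mem_carrier[OF normal_imp_subgroup[OF N(1)] x] by (simp add: kernel_def)
    qed
    ultimately have "supersolvable ?Q"
      using group_hom.normal_cyclic_series_image[OF comp_hom _ N(1) _ T.supersolvable_quotient_series[OF N]]
        gN.factorgroup_is_group by (simp add: supersolvable_def)
    then have "y \<in> conj_set G g N"
      using y gN unfolding supersolvable_residual_def by blast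
    then show ?thesis
      using mem_conj_set_iff[OF N_sub g y_carr] by blast
  qed
  then have "inv g \<otimes> y \<otimes> g \<in> supersolvable_residual ?T"
    unfolding supersolvable_residual_def by blast
  then show "y \<in> conj_set G g (supersolvable_residual ?T)"
    using mem_conj_set_iff[OF _ g y_carr] subgroup_residual_subset[OF T] T_sub by blast
qed

lemma residual_conj:
  assumes T: "subgroup T G" and g: "g \<in> carrier G"
  shows "supersolvable_residual (G\<lparr>carrier := conj_set G g T\<rparr>) = conj_set G g (supersolvable_residual (G\<lparr>carrier := T\<rparr>))"
proof
  let ?R = "\<lambda>T. supersolvable_residual (G\<lparr>carrier := T\<rparr>)"
  show "?R (conj_set G g T) \<subseteq> conj_set G g (?R T)"
    using residual_conj_subset[OF T g] .
  have gT: "subgroup (conj_set G g T) G"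
    using conj_set_subgroup[OF T g] .
  have sub: "?R (conj_set G g T) \<subseteq> carrier G"
    using subgroup_residual_subset[OF gT] subgroup.subset[OF gT] by blast
  have "?R T \<subseteq> conj_set G (inv g) (?R (conj_set G g T))"
    using residual_conj_subset[OF gT, of "inv g"] g conj_set_inv[OF subgroup.subset[OF T] g] by simp
  then have "conj_set G g (?R T) \<subseteq> conj_set G g (conj_set G (inv g) (?R (conj_set G g T)))"
    by (rule conj_set_mono)
  also have "\<dots> = ?R (conj_set G g T)"
    using conj_set_inv[OF sub, of "inv g"] g by simp
  finally show "conj_set G g (?R T) \<subseteq> ?R (conj_set G g T)" .
qed

lemma mem_supersolvable_norm_iff:
  "g \<in> supersolvable_norm G \<longleftrightarrow> g \<in> carrier G \<and>
    (\<forall>T. subgroup T G \<longrightarrow> conj_set G g (supersolvable_residual (G\<lparr>carrier := T\<rparr>)) =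
      supersolvable_residual (G\<lparr>carrier := T\<rparr>))"
proof -
  have "supersolvable_residual (G\<lparr>carrier := T\<rparr>) \<subseteq> carrier G" if "subgroup T G" for T
    using subgroup_residual_subset[OF that] subgroup.subset[OF that] by blast
  then have iff: "g \<in> normalizer G (supersolvable_residual (G\<lparr>carrier := T\<rparr>)) \<longleftrightarrow> g \<in> carrier G \<and>
      conj_set G g (supersolvable_residual (G\<lparr>carrier := T\<rparr>)) = supersolvable_residual (G\<lparr>carrier := T\<rparr>)"
    if "subgroup T G" for T
    using mem_normalizer_iff that by simp
  have "g \<in> supersolvable_norm G \<longleftrightarrow>
      (\<forall>T. subgroup T G \<longrightarrow> g \<in> normalizer G (supersolvable_residual (G\<lparr>carrier := T\<rparr>)))"
    by (simp add: supersolvable_norm_def)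
  then show ?thesis
    using iff subgroup_self by auto
qed

text \<open>If \<open>x\<close> normalizes the residual of \<open>g\<^sup>-\<^sup>1 T g\<close>, then \<open>g x g\<^sup>-\<^sup>1\<close> normalizes the residual of \<open>T\<close>.\<close>

lemma supersolvable_norm_normal: "supersolvable_norm G \<lhd> G"
proof (rule normal_invI)
  let ?R = "\<lambda>T. supersolvable_residual (G\<lparr>carrier := T\<rparr>)"
  have R_sub: "?R T \<subseteq> carrier G" if "subgroup T G" for T
    using subgroup_residual_subset[OF that] subgroup.subset[OF that] by blast
  show "subgroup (supersolvable_norm G) G"
    unfolding supersolvable_norm_def
  proof (rule subgroups_Inter)
    fix H assume "H \<in> (\<lambda>T. normalizer G (?R T)) ` {T. subgroup T G}"
    then show "subgroup H G"
      using normalizer_imp_subgroup R_sub by auto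
  next
    show "(\<lambda>T. normalizer G (?R T)) ` {T. subgroup T G} \<noteq> {}"
      using subgroup_self by auto
  qed
  fix g x assume g: "g \<in> carrier G" and x: "x \<in> supersolvable_norm G"
  then have x_carr: "x \<in> carrier G" and x_R: "\<And>T. subgroup T G \<Longrightarrow> conj_set G x (?R T) = ?R T"
    using mem_supersolvable_norm_iff by auto
  have "conj_set G (g \<otimes> x \<otimes> inv g) (?R T) = ?R T" if T: "subgroup T G" for T
  proof -
    let ?T' = "conj_set G (inv g) T"
    have T': "subgroup ?T' G"
      using conj_set_subgroup[OF T] g by simp
    have "conj_set G g ?T' = T"
      using conj_set_inv[OF subgroup.subset[OF T], of "inv g"] g by simp
    then have R_T: "?R T = conj_set G g (?R ?T')"
      using residual_conj[OF T' g] by simp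
    have "conj_set G (g \<otimes> x \<otimes> inv g) (?R T) = conj_set G (g \<otimes> x) (conj_set G (inv g) (?R T))"
      using R_sub[OF T] g x_carr by (simp add: conj_set_mult)
    also have "conj_set G (inv g) (?R T) = ?R ?T'"
      unfolding R_T using conj_set_inv[OF R_sub[OF T'] g] .
    also have "conj_set G (g \<otimes> x) (?R ?T') = conj_set G g (conj_set G x (?R ?T'))"
      using R_sub[OF T'] g x_carr by (simp add: conj_set_mult)
    also have "\<dots> = ?R T"
      unfolding x_R[OF T'] R_T[symmetric] ..
    finally show ?thesis .
  qed
  then show "g \<otimes> x \<otimes> inv g \<in> supersolvable_norm G"
    unfolding mem_supersolvable_norm_iff using g x_carr by simp
qed

end

lemma (in comm_group) comm_group_solvable: "solvable G"
  unfolding solvable_def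
  using trivial_derived_seq_imp_solvable[OF subgroup_self, of 1] derived_eq_singleton by simp

lemma (in group) solvable_extension:
  assumes N: "N \<lhd> G" and sub: "solvable (G\<lparr>carrier := N\<rparr>)" and quot: "solvable (G Mod N)"
  shows "solvable G"
proof (rule solvable_condition[OF _ _ _ _ sub quot])
  show "group_hom (G\<lparr>carrier := N\<rparr>) G id"
    using canonical_inj_is_hom[OF normal_imp_subgroup[OF N]] .
  show "group_hom G (G Mod N) (\<lambda>x. N #> x)"
    using normal.coset_map_group_hom[OF N] .
  show "(\<lambda>x. N #> x) ` carrier G = carrier (G Mod N)"
    using normal.coset_map_surj[OF N] .
  show "kernel G (G Mod N) (\<lambda>x. N #> x) \<subseteq> id ` carrier (G\<lparr>carrier := N\<rparr>)"
    using normal.coset_map_eq_one_iff[OF N] by (auto simp: kernel_def simp del: one_FactGroup)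
qed

text \<open>It suffices to show that each proper subgroup \<open>U\<close> of the simple group \<open>G / S\<close> is supersolvable. Let \<open>T\<close> be
  its preimage. The residual of \<open>T\<close> is normal in \<open>G\<close>, so its image is a normal subgroup of \<open>G / S\<close>
  inside \<open>U\<close>, hence trivial. Thus the residual of \<open>T\<close> lies in \<open>S\<close>, and \<open>U = T / S\<close> is a quotient of
  \<open>T\<close> modulo its residual, which is supersolvable.\<close>

lemma (in group) quotient_by_maximal_normal_solvable:
  assumes fin: "finite (carrier G)"
    and conj_R: "\<And>T g. subgroup T G \<Longrightarrow> g \<in> carrier G \<Longrightarrow>
      conj_set G g (supersolvable_residual (G\<lparr>carrier := T\<rparr>)) = supersolvable_residual (G\<lparr>carrier := T\<rparr>)"
    and S: "S \<lhd> G" and S_max: "\<And>N. N \<lhd> G \<Longrightarrow> S \<subseteq> N \<Longrightarrow> N = S \<or> N = carrier G"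
  shows "solvable (G Mod S)"
proof -
  let ?R = "\<lambda>T. supersolvable_residual (G\<lparr>carrier := T\<rparr>)"
  interpret S: normal S G by (rule S)
  let ?Q = "G Mod S" and ?\<pi> = "\<lambda>x. S #> x"
  interpret \<pi>: group_hom G ?Q ?\<pi> by (rule S.coset_map_group_hom)
  have simple: "M = carrier ?Q \<or> M = {\<one>\<^bsub>?Q\<^esub>}" if "M \<lhd> ?Q" for M
    using quotient_by_maximal_normal_simple[OF S S_max that] .
  have "comm_group ?Q"
  proof (rule \<pi>.H.simple_group_with_supersolvable_subgroups_comm[OF _ simple])
    show "finite (carrier ?Q)"
      using fin by (simp add: carrier_FactGroup)
    fix U assume U: "subgroup U ?Q" "U \<noteq> carrier ?Q"
    define T where "T = {x \<in> carrier G. ?\<pi> x \<in> U}"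
    have T: "subgroup T G"
      unfolding T_def using U(1)
      by (intro subgroupI) (auto simp: subgroup.m_closed subgroup.m_inv_closed subgroup.one_closed simp del: one_FactGroup mult_FactGroup)
    have T_img: "?\<pi> ` T = U"
      using subgroup.subset[OF U(1)] unfolding T_def S.coset_map_surj[symmetric] by blast
    interpret T: group "G\<lparr>carrier := T\<rparr>"
      using subgroup_imp_group[OF T] .
    have finT: "finite (carrier (G\<lparr>carrier := T\<rparr>))"
      using finite_subset[OF subgroup.subset[OF T] fin] by simp
    note R = T.supersolvable_residual_series[OF finT]
    have R_T: "?R T \<subseteq> T"
      using subgroup_residual_subset[OF T] .
    have R_sub: "subgroup (?R T) G"
      using incl_subgroup[OF T normal_imp_subgroup] R by blast
    have "?R T \<lhd> G"
    proof (rule normal_invI[OF R_sub])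
      fix g x assume "g \<in> carrier G" "x \<in> ?R T"
      then have "g \<otimes> x \<otimes> inv g \<in> conj_set G g (?R T)"
        by (auto simp: conj_set_def)
      then show "g \<otimes> x \<otimes> inv g \<in> ?R T"
        using conj_R[OF T \<open>g \<in> carrier G\<close>] by simp
    qed
    then have "?\<pi> ` ?R T \<lhd> ?Q"
      using normal.surj_hom_normal_subgroup[OF _ \<pi>.group_hom_axioms S.coset_map_surj] by blast
    moreover have "?\<pi> ` ?R T \<noteq> carrier ?Q"
      using R_T T_img U(2) subgroup.subset[OF U(1)] by blast
    ultimately have R_one: "?\<pi> ` ?R T = {\<one>\<^bsub>?Q\<^esub>}"
      using simple by blast
    have hom: "group_hom (G\<lparr>carrier := T\<rparr>) (?Q\<lparr>carrier := U\<rparr>) ?\<pi>"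
    proof -
      have "?\<pi> \<in> hom (G\<lparr>carrier := T\<rparr>) (?Q\<lparr>carrier := U\<rparr>)"
        using \<pi>.hom_mult T_img subgroup.mem_carrier[OF T] by (auto intro!: homI simp del: mult_FactGroup)
      then show ?thesis
        using T.is_group \<pi>.H.subgroup_imp_group[OF U(1)]
        by (simp add: group_hom_def group_hom_axioms_def)
    qed
    have "?R T \<subseteq> kernel (G\<lparr>carrier := T\<rparr>) (?Q\<lparr>carrier := U\<rparr>) ?\<pi>"
      using R_one R_T unfolding kernel_def by auto
    then have "supersolvable_seq (?Q\<lparr>carrier := U\<rparr>) (?\<pi> ` carrier (G\<lparr>carrier := T\<rparr>))"
      using R T_img by (intro group_hom.normal_cyclic_series_image[OF hom]) auto
    then show "supersolvable (?Q\<lparr>carrier := U\<rparr>)"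
      using \<pi>.H.subgroup_imp_group[OF U(1)] T_img by (simp add: supersolvable_def)
  qed
  then show ?thesis
    by (rule comm_group.comm_group_solvable)
qed

text \<open>Subgroups inherit the hypothesis, so by induction a maximal proper normal subgroup is solvable.\<close>

theorem residuals_normal_imp_solvable:
  fixes G :: "('a, 'b) monoid_scheme"
  assumes "group G" "finite (carrier G)"
    and "\<And>T g. subgroup T G \<Longrightarrow> g \<in> carrier G \<Longrightarrow>
      conj_set G g (supersolvable_residual (G\<lparr>carrier := T\<rparr>)) = supersolvable_residual (G\<lparr>carrier := T\<rparr>)"
  shows "solvable G"
  using assms
proof (induction "order G" arbitrary: G rule: less_induct)
  case less
  interpret group G by (rule less.prems(1))
  note fin = less.prems(2) and conj_R = less.prems(3)
  show ?case
  proof (cases "carrier G = {\<one>\<^bsub>G\<^esub>}")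
    case True
    then show ?thesis
      using solvable_seq.unity[of G] by (simp add: solvable_def)
  next
    case False
    obtain S where S: "S \<lhd> G" "S \<noteq> carrier G" and S_max: "\<And>N. N \<lhd> G \<Longrightarrow> S \<subseteq> N \<Longrightarrow> N = S \<or> N = carrier G"
      by (rule maximal_normal_subgroup_exists[OF fin False]) (rule that)
    interpret S: normal S G by (rule S(1))
    have finS: "finite S"
      using finite_subset[OF S.subset fin] .
    have "solvable (G\<lparr>carrier := S\<rparr>)"
    proof (rule less.hyps)
      have "S \<subset> carrier G"
        using S.subset S(2) by blast
      then show "order (G\<lparr>carrier := S\<rparr>) < order G"
        using fin by (simp add: order_def psubset_card_mono)
      show "group (G\<lparr>carrier := S\<rparr>)" "finite (carrier (G\<lparr>carrier := S\<rparr>))"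
        using subgroup_imp_group[OF S.subgroup_axioms] finS by auto
      fix T g assume T: "subgroup T (G\<lparr>carrier := S\<rparr>)" and g: "g \<in> carrier (G\<lparr>carrier := S\<rparr>)"
      have "subgroup T G"
        using incl_subgroup[OF S.subgroup_axioms T] .
      moreover have "conj_set (G\<lparr>carrier := S\<rparr>) g Y = conj_set G g Y" for Y
        using m_inv_consistent[OF S.subgroup_axioms, of g] g by (simp add: conj_set_def)
      ultimately show "conj_set (G\<lparr>carrier := S\<rparr>) g (supersolvable_residual (G\<lparr>carrier := S, carrier := T\<rparr>)) =
          supersolvable_residual (G\<lparr>carrier := S, carrier := T\<rparr>)"
        using conj_R g by simp
    qed
    then show ?thesis
      by (rule solvable_extension[OF S(1) _ quotient_by_maximal_normal_solvable[OF fin conj_R S(1) S_max]])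
  qed
qed

text \<open>Subgroups of the norm are subgroups of \<open>G\<close>, so the norm normalizes all their residuals.\<close>

lemma (in group) supersolvable_norm_solvable:
  assumes fin: "finite (carrier G)"
  shows "solvable (G\<lparr>carrier := supersolvable_norm G\<rparr>)"
proof (rule residuals_normal_imp_solvable)
  let ?N = "supersolvable_norm G"
  have N: "subgroup ?N G"
    using normal_imp_subgroup[OF supersolvable_norm_normal] .
  show "group (G\<lparr>carrier := ?N\<rparr>)" "finite (carrier (G\<lparr>carrier := ?N\<rparr>))"
    using subgroup_imp_group[OF N] finite_subset[OF subgroup.subset[OF N] fin] by auto
  fix T g assume T: "subgroup T (G\<lparr>carrier := ?N\<rparr>)" and g: "g \<in> carrier (G\<lparr>carrier := ?N\<rparr>)"
  have "conj_set (G\<lparr>carrier := ?N\<rparr>) g Y = conj_set G g Y" for Y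
    using m_inv_consistent[OF N, of g] g by (simp add: conj_set_def)
  then show "conj_set (G\<lparr>carrier := ?N\<rparr>) g (supersolvable_residual (G\<lparr>carrier := ?N, carrier := T\<rparr>)) =
      supersolvable_residual (G\<lparr>carrier := ?N, carrier := T\<rparr>)"
    using g incl_subgroup[OF N T] by (simp add: mem_supersolvable_norm_iff)
qed

text \<open>Normality of the terms is carried along since only then the quotient that defines the next term is a group.
  Each factor is the norm of such a quotient, hence solvable.\<close>

lemma (in group) supersolvable_norm_series_normal_solvable:
  assumes fin: "finite (carrier G)"
  shows "supersolvable_norm_series G i \<lhd> G \<and> solvable_seq G (supersolvable_norm_series G i)"
proof (induction i)
  case 0
  show ?case
    by (simp add: one_is_normal solvable_seq.unity)
next
  case (Suc i)
  let ?N = "supersolvable_norm_series G i" and ?M = "supersolvable_norm_series G (Suc i)"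
  interpret N: normal ?N G
    using Suc.IH by blast
  let ?Q = "G Mod ?N" and ?\<pi> = "\<lambda>x. ?N #> x"
  interpret \<pi>: group_hom G ?Q ?\<pi> by (rule N.coset_map_group_hom)
  have M: "?M \<lhd> G"
    using \<pi>.normal_preimage[OF \<pi>.H.supersolvable_norm_normal] by simp
  have finQ: "finite (carrier ?Q)"
    using fin by (simp add: carrier_FactGroup)
  have norm_sub: "subgroup (supersolvable_norm ?Q) ?Q"
    using normal_imp_subgroup[OF \<pi>.H.supersolvable_norm_normal] .
  have "supersolvable_norm ?Q \<subseteq> ?\<pi> ` carrier G"
    using subgroup.subset[OF norm_sub] unfolding N.coset_map_surj .
  then have img: "?\<pi> ` ?M = supersolvable_norm ?Q"
    by auto
  have "solvable_seq ?Q (id ` carrier (?Q\<lparr>carrier := supersolvable_norm ?Q\<rparr>))"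
    using group_hom.solvable_imp_solvable_img[OF \<pi>.H.canonical_inj_is_hom[OF norm_sub]]
      \<pi>.H.supersolvable_norm_solvable[OF finQ] unfolding solvable_def by blast
  then have quot: "solvable_seq ?Q (?\<pi> ` ?M)"
    unfolding img by simp
  have "solvable_seq G ?M"
  proof (rule solvable_seq_condition[OF _ \<pi>.group_hom_axioms _ _ _ _ quot])
    show "group_hom G G id"
      using canonical_inj_is_hom[OF subgroup_self] by simp
    show "solvable_seq G ?N"
      using Suc.IH by blast
    show "subgroup ?M G"
      using normal_imp_subgroup[OF M] .
    have "x \<in> ?M" if x: "x \<in> ?N" for x
    proof -
      have "?\<pi> x = \<one>\<^bsub>?Q\<^esub>"
        using N.coset_map_eq_one_iff[of x] x by simp
      then show ?thesis
        using subgroup.one_closed[OF norm_sub] x by simp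
    qed
    then show "id ` ?N \<subseteq> ?M"
      by auto
    show "kernel G ?Q ?\<pi> \<subseteq> id ` ?N"
      using N.coset_map_eq_one_iff by (auto simp: kernel_def simp del: one_FactGroup)
  qed
  then show ?case
    using M by blast
qed

theorem theorem4p4:
  fixes G :: "('a, 'b) monoid_scheme"
  assumes "group G" and "finite (carrier G)"
  shows "(carrier G = supersolvable_norm G \<longrightarrow> solvable G)
    \<and> solvable (G\<lparr>carrier := supersolvable_norm G\<rparr>)
    \<and> solvable (G\<lparr>carrier := supersolvable_norm_infinity G\<rparr>)"
proof -
  interpret group G by (rule assms(1))
  have norm: "solvable (G\<lparr>carrier := supersolvable_norm G\<rparr>)"
    using supersolvable_norm_solvable[OF assms(2)] .
  \<comment> \<open>Every term of the series is solvable, so it does not matter which one is terminal.\<close>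
  obtain i where i: "supersolvable_norm_infinity G = supersolvable_norm_series G i"
    by (simp add: supersolvable_norm_infinity_def)
  let ?N = "supersolvable_norm_series G i"
  have N: "subgroup ?N G" "solvable_seq G ?N"
    using supersolvable_norm_series_normal_solvable[OF assms(2), of i] normal_imp_subgroup by auto
  have "solvable_seq (G\<lparr>carrier := ?N\<rparr>) ?N"
    using group_hom.solvable_img_imp_solvable[OF canonical_inj_is_hom[OF N(1)], of ?N] N(2)
      group.subgroup_self[OF subgroup_imp_group[OF N(1)]] by simp
  then have "solvable (G\<lparr>carrier := supersolvable_norm_infinity G\<rparr>)"
    by (simp add: solvable_def i)
  moreover have "G\<lparr>carrier := supersolvable_norm G\<rparr> = G" if "carrier G = supersolvable_norm G"
    unfolding that[symmetric] by simp
  ultimately show ?thesis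
    using norm by metis
qed

end
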